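(* Let $f$ be $(\delta_f,L_f)$-approximately smooth with components $(\bar f,\bar g)$, let $\|x-y\|\le D$ for all $x,y\in\operatorname{dom}\psi$, and let $\hat g$ be an unbiased stochastic oracle for $\bar g$ with $\sigma^2:=\sup_{x\in\operatorname{dom}\psi}\mathrm{Var}_{\hat g}(x)<+\infty$. Let $(x_k)$ be the points generated by UniversalFastSgd (defined in the context) from a point $x_0\in\operatorname{dom}\psi$ with diameter parameter $D$ and a stepsize update rule $M_+(\cdot)$ satisfying the requirement (R) of the context with constants $c_1,c_2,c_3,c_4>0$. Then, for any $k\ge1$, $$\mathbb E[F(x_k)]-F^*\le\frac{4c_2c_4L_fD^2}{k(k+1)}+4\sigma D\sqrt{\frac{2c_1c_4}{3k}}+\frac{c_3}{3}(k+2)\delta_f .$$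
   Context: Space: $\mathbb R^d$ with standard inner product $\langle\cdot,\cdot\rangle$, norm $\|x\|=\langle Bx,x\rangle^{1/2}$ ($B$ a fixed positive definite matrix), dual norm $\|s\|_*=\max_{\|x\|=1}\langle s,x\rangle=\langle s,B^{-1}s\rangle^{1/2}$. $[t]_+=\max\{t,0\}$. All expectations are assumed well defined. Problem: $F^*=\min_{x\in\operatorname{dom}\psi}[F(x):=f(x)+\psi(x)]$, where $f:\mathbb R^d\to\mathbb R$ is convex, $\psi:\mathbb R^d\to\mathbb R\cup\{+\infty\}$ is proper closed convex, $\operatorname{dom}\psi=\{x:\psi(x)<+\infty\}$; a solution $x^*$ is assumed to exist. Approximate smoothness: $f$ is $(\delta_f,L_f)$-approximately smooth ($\delta_f,L_f\ge0$) with components $\bar f:\mathbb R^d\to\mathbb R$, $\bar g:\mathbb R^d\to\mathbb R^d$ if $\beta(x,y):=f(y)-\bar f(x)-\langle\bar g(x),y-x\rangle$ satisfies $0\le\beta(x,y)\le\frac{L_f}{2}\|x-y\|^2+\delta_f$ for all $x,y\in\mathbb R^d$. Stochastic oracle: $\hat g=(g,\xi)$ is a random variable $\xi$ with a mapping $g$; a query at $x$ returns $g(x,\xi)$ with a fresh independent copy of $\xi$. It is unbiased for $\bar g$ if $\mathbb E_\xi[g(x,\xi)]=\bar g(x)$ for all $x$. $\mathrm{Var}_{\hat g}(x)=\mathbb E_\xi[\|g(x,\xi)-\bar g(x)\|_*^2]$. Proximal map: $\mathrm{Prox}_\psi(x,g,M)=\operatorname{argmin}_{y\in\operatorname{dom}\psi}\{\langle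 g,y\rangle+\psi(y)+\frac M2\|y-x\|^2\}$, $M\ge 0$ (if $M=0$, any minimizer may be chosen). Requirement (R) on the stepsize update rule $M_+$ with constants $c_1,\dots,c_4>0$: let $\Omega>0$ be a constant, $x\in\operatorname{dom}\psi$ a (possibly random) current point, $\hat g_x$ the output of a query of $\hat g$ at $x$, $M\ge0$ a coefficient and $\hat x_+\in\operatorname{dom}\psi$ a random point (both possibly dependent on $\hat g_x$), and $\hat g_{x_+}$ the output of a query of $\hat g$ at $\hat x_+$ with fresh randomness independent of everything else. Then $\hat M_+=M_+(M,\Omega,x,\hat x_+,\hat g_x,\hat g_{x_+})$ satisfies $\hat M_+\ge M$ and, for every constant $\bar M>c_2L_f$, $$\mathbb E[\hat\Delta(\hat M_+)+(\hat M_+-M)\Omega+\beta(\hat x_+,x)]\le\frac{c_1}{\bar M-c_2L_f}\mathbb E[\mathrm{Var}_{\hat g}(\hat x_+)+\mathrm{Var}_{\hat g}(x)]+c_3\delta_f+c_4\mathbb E\{[\min\{\hat M_+,\bar M\}-M]_+\Omega\},$$ where $\hat\Delta(\hat M_+)=\beta(x,\hat x_+)+\langle\bar g(x)-\hat g_x,\hat x_+-x\rangle-\frac{\hat M_+}{2}\|\hat x_+-x\|^2$ and the expectation is over all randomness. (Main example: $\hat M_+=\sqrt{M^2+\frac1\Omega\|\hat g_{x_+}-\hat g_x\|_*^2}$, with $c_1=\frac52,c_2=4,c_3=6,c_4=2$.) UniversalFastSgd with oracle $\hat g$, inputs $x_0\in\operatorname{dom}\psi$, $D$: set $v_0=x_0$,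 $M_0=A_0=0$. For $k=0,1,\dots$: $a_{k+1}=\frac12(k+1)$, $A_{k+1}=A_k+a_{k+1}$; $y_k=\frac{A_k}{A_{k+1}}x_k+\frac{a_{k+1}}{A_{k+1}}v_k$; query $g_{y_k}$ from $\hat g$ at $y_k$; $v_{k+1}=\mathrm{Prox}_\psi(v_k,g_{y_k},\frac{M_k}{a_{k+1}})$; $x_{k+1}=\frac{A_k}{A_{k+1}}x_k+\frac{a_{k+1}}{A_{k+1}}v_{k+1}$; query $g_{x_{k+1}}$ from $\hat g$ at $x_{k+1}$; $M_{k+1}=\frac{a_{k+1}^2}{A_{k+1}}M_+\bigl(\frac{A_{k+1}}{a_{k+1}^2}M_k,\frac{a_{k+1}^2}{A_{k+1}^2}D^2,y_k,x_{k+1},g_{y_k},g_{x_{k+1}}\bigr)$. *)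

theory Defs
  imports "HOL-Probability.Probability"
begin

section \<open>Norms induced by a positive definite matrix\<close>

definition positive_definite :: "real^'n^'n \<Rightarrow> bool" where
  "positive_definite B \<longleftrightarrow> transpose B = B \<and> (\<forall>x. x \<noteq> 0 \<longrightarrow> (B *v x) \<bullet> x > 0)"

definition mnorm :: "real^'n^'n \<Rightarrow> real^'n \<Rightarrow> real" where
  "mnorm B x = sqrt ((B *v x) \<bullet> x)"

definition dual_norm :: "real^'n^'n \<Rightarrow> real^'n \<Rightarrow> real" where
  "dual_norm B s = Sup {s \<bullet> x | x. mnorm B x = 1}"

section \<open>Composite convex problem\<close>

definition effective_domain :: "('a \<Rightarrow> ereal) \<Rightarrow> 'a set" where
  "effective_domain psi = {x. psi x < \<infinity>}"

definition proper_closed_convex :: "(real^'n \<Rightarrow> ereal) \<Rightarrow> bool" where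
  "proper_closed_convex psi \<longleftrightarrow>
     effective_domain psi \<noteq> {} \<and> (\<forall>x. psi x \<noteq> -\<infinity>) \<and>
     closed {(x, t::real). psi x \<le> ereal t} \<and> convex {(x, t::real). psi x \<le> ereal t}"

definition objective :: "(real^'n \<Rightarrow> real) \<Rightarrow> (real^'n \<Rightarrow> ereal) \<Rightarrow> real^'n \<Rightarrow> ereal" where
  "objective f psi x = ereal (f x) + psi x"

definition model_error ::
  "(real^'n \<Rightarrow> real) \<Rightarrow> (real^'n \<Rightarrow> real) \<Rightarrow> (real^'n \<Rightarrow> real^'n) \<Rightarrow> real^'n \<Rightarrow> real^'n \<Rightarrow> real" where
  "model_error f fbar gbar x y = f y - fbar x - gbar x \<bullet> (y - x)"

definition approximately_smooth ::
  "real^'n^'n \<Rightarrow> (real^'n \<Rightarrow> real) \<Rightarrow> (real^'n \<Rightarrow> real) \<Rightarrow> (real^'n \<Rightarrow> real^'n) \<Rightarrow> real \<Rightarrow> real \<Rightarrow> bool" where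
  "approximately_smooth B f fbar gbar \<delta> L \<longleftrightarrow> \<delta> \<ge> 0 \<and> L \<ge> 0 \<and>
     (\<forall>x y. 0 \<le> model_error f fbar gbar x y \<and>
            model_error f fbar gbar x y \<le> L / 2 * (mnorm B (x - y))\<^sup>2 + \<delta>)"

definition prox_set ::
  "real^'n^'n \<Rightarrow> (real^'n \<Rightarrow> ereal) \<Rightarrow> real^'n \<Rightarrow> real^'n \<Rightarrow> real \<Rightarrow> (real^'n) set" where
  "prox_set B psi x g M =
     {y. is_arg_min (\<lambda>z. ereal (g \<bullet> z) + psi z + ereal (M / 2 * (mnorm B (z - x))\<^sup>2))
           (\<lambda>z. z \<in> effective_domain psi) y}"

section \<open>Extended expectations\<close>

text \<open>
  The expectation is taken in the extended sense, as the difference of the integrals of the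
  positive and the negative part; it is well defined for a measurable function for which at least
  one of the two is finite. (The map \<^const>\<open>e2ennreal\<close> sends negative numbers to 0.)
\<close>

definition well_defined_expectation :: "'w measure \<Rightarrow> ('w \<Rightarrow> ereal) \<Rightarrow> bool" where
  "well_defined_expectation P X \<longleftrightarrow> X \<in> borel_measurable P \<and>
     ((\<integral>\<^sup>+w. e2ennreal (X w) \<partial>P) < \<infinity> \<or> (\<integral>\<^sup>+w. e2ennreal (- X w) \<partial>P) < \<infinity>)"

definition ext_expectation :: "'w measure \<Rightarrow> ('w \<Rightarrow> ereal) \<Rightarrow> ereal" where
  "ext_expectation P X =
     enn2ereal (\<integral>\<^sup>+w. e2ennreal (X w) \<partial>P) - enn2ereal (\<integral>\<^sup>+w. e2ennreal (- X w) \<partial>P)"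

text \<open>
  The library's notion \<^const>\<open>prob_space.indep_var\<close> requires both random variables to have the same
  type, so independence of the generated \<open>\<sigma>\<close>-algebras is stated directly.
\<close>

definition independent_variables ::
  "'w measure \<Rightarrow> 'a measure \<Rightarrow> ('w \<Rightarrow> 'a) \<Rightarrow> 'b measure \<Rightarrow> ('w \<Rightarrow> 'b) \<Rightarrow> bool" where
  "independent_variables P S X T Y \<longleftrightarrow> X \<in> measurable P S \<and> Y \<in> measurable P T \<and>
     prob_space.indep_set P
       (sets (vimage_algebra (space P) X S)) (sets (vimage_algebra (space P) Y T))"

section \<open>Stochastic oracles\<close>

text \<open>An oracle consists of the law \<open>Q\<close> of \<open>\<xi>\<close> and the map \<open>g\<close>.\<close>

definition stochastic_oracle :: "'q measure \<Rightarrow> (real^'n \<Rightarrow> 'q \<Rightarrow> real^'n) \<Rightarrow> bool" where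
  "stochastic_oracle Q g \<longleftrightarrow>
     prob_space Q \<and> (\<lambda>(x, q). g x q) \<in> borel_measurable (borel \<Otimes>\<^sub>M Q)"

definition unbiased_oracle ::
  "'q measure \<Rightarrow> (real^'n \<Rightarrow> 'q \<Rightarrow> real^'n) \<Rightarrow> (real^'n \<Rightarrow> real^'n) \<Rightarrow> bool" where
  "unbiased_oracle Q g gbar \<longleftrightarrow>
     (\<forall>x. integrable Q (g x) \<and> (\<integral>q. g x q \<partial>Q) = gbar x)"

definition oracle_variance ::
  "real^'n^'n \<Rightarrow> 'q measure \<Rightarrow> (real^'n \<Rightarrow> 'q \<Rightarrow> real^'n) \<Rightarrow> (real^'n \<Rightarrow> real^'n) \<Rightarrow> real^'n \<Rightarrow> ereal" where
  "oracle_variance B Q g gbar x =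
     ext_expectation Q (\<lambda>q. ereal ((dual_norm B (g x q - gbar x))\<^sup>2))"

section \<open>Stepsize update rules\<close>

type_synonym 'n stepsize_rule =
  "real \<Rightarrow> real \<Rightarrow> real^'n \<Rightarrow> real^'n \<Rightarrow> real^'n \<Rightarrow> real^'n \<Rightarrow> real"

text \<open>
  Borel measurability makes the output of the rule a random variable whenever its inputs are.
\<close>

definition measurable_rule :: "'n::finite stepsize_rule \<Rightarrow> bool" where
  "measurable_rule Mplus \<longleftrightarrow>
     (\<forall>\<Omega>>0. (\<lambda>(M, x, x', gx, gx'). Mplus M \<Omega> x x' gx gx') \<in> borel_measurable borel)"

text \<open>
  All random variables live on the ambient probability space \<open>P\<close>. The randomness \<open>q\<close> of the query
  at \<open>x\<close> is independent of \<open>x\<close>, whereas \<open>M\<close> and \<open>x'\<close> may depend on \<open>q\<close>; the randomness \<open>q'\<close> of the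
  query at \<open>x'\<close> is independent of all the rest.
\<close>

definition stepsize_requirement ::
  "real^'n^'n \<Rightarrow> (real^'n \<Rightarrow> real) \<Rightarrow> (real^'n \<Rightarrow> real) \<Rightarrow> (real^'n \<Rightarrow> real^'n) \<Rightarrow>
   real \<Rightarrow> real \<Rightarrow> (real^'n \<Rightarrow> ereal) \<Rightarrow> 'q measure \<Rightarrow> (real^'n \<Rightarrow> 'q \<Rightarrow> real^'n) \<Rightarrow>
   'w measure \<Rightarrow> 'n stepsize_rule \<Rightarrow> real \<Rightarrow> real \<Rightarrow> real \<Rightarrow> real \<Rightarrow> bool" where
  "stepsize_requirement B f fbar gbar \<delta> L psi Q g P Mplus c1 c2 c3 c4 \<longleftrightarrow>
    (\<forall>\<Omega> x x' M q q'.
       \<Omega> > 0 \<and>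
       x \<in> borel_measurable P \<and> (\<forall>w\<in>space P. x w \<in> effective_domain psi) \<and>
       x' \<in> borel_measurable P \<and> (\<forall>w\<in>space P. x' w \<in> effective_domain psi) \<and>
       M \<in> borel_measurable P \<and> (\<forall>w\<in>space P. M w \<ge> 0) \<and>
       q \<in> measurable P Q \<and> distr P Q q = Q \<and>
       q' \<in> measurable P Q \<and> distr P Q q' = Q \<and>
       independent_variables P borel x Q q \<and>
       independent_variables P (borel \<Otimes>\<^sub>M Q \<Otimes>\<^sub>M borel \<Otimes>\<^sub>M borel) (\<lambda>w. (x w, q w, M w, x' w)) Q q'
     \<longrightarrow>
       (let gx = (\<lambda>w. g (x w) (q w));
            gx' = (\<lambda>w. g (x' w) (q' w));
            M' = (\<lambda>w. Mplus (M w) \<Omega> (x w) (x' w) (gx w) (gx' w));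
            \<Delta> = (\<lambda>w. model_error f fbar gbar (x w) (x' w) + (gbar (x w) - gx w) \<bullet> (x' w - x w)
                      - M' w / 2 * (mnorm B (x' w - x w))\<^sup>2);
            lhs = (\<lambda>w. ereal (\<Delta> w + (M' w - M w) * \<Omega> + model_error f fbar gbar (x' w) (x w)))
        in (\<forall>w\<in>space P. M' w \<ge> M w) \<and>
           (\<forall>Mbar. Mbar > c2 * L \<longrightarrow> well_defined_expectation P lhs \<longrightarrow>
              ext_expectation P lhs \<le>
                ereal (c1 / (Mbar - c2 * L)) *
                  ext_expectation P
                    (\<lambda>w. oracle_variance B Q g gbar (x' w) + oracle_variance B Q g gbar (x w))
                + ereal (c3 * \<delta>)
                + ereal c4 *
                  ext_expectation P (\<lambda>w. ereal (max (min (M' w) Mbar - M w) 0 * \<Omega>)))))"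

section \<open>The method UniversalFastSgd\<close>

definition a_seq :: "nat \<Rightarrow> real" where
  "a_seq k = real k / 2"

primrec A_seq :: "nat \<Rightarrow> real" where
  "A_seq 0 = 0"
| "A_seq (Suc k) = A_seq k + a_seq (Suc k)"

definition history :: "'w measure \<Rightarrow> 'q measure \<Rightarrow> (nat \<Rightarrow> 'w \<Rightarrow> 'q) \<Rightarrow> nat \<Rightarrow> 'w measure" where
  "history P Q \<xi> n =
     vimage_algebra (space P) (\<lambda>w. \<lambda>i\<in>{..<n}. \<xi> i w) (Pi\<^sub>M {..<n} (\<lambda>_. Q))"

text \<open>
  Iteration \<open>k\<close> uses the copy \<open>\<xi> (2 * k)\<close> for the query at \<open>y\<^sub>k\<close> and \<open>\<xi> (2 * k + 1)\<close> for the query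
  at \<open>x\<^sub>k\<^sub>+\<^sub>1\<close>. Any element of the (possibly non-unique, when \<open>M\<^sub>k = 0\<close>) set of proximal points may be
  taken for \<open>v\<^sub>k\<^sub>+\<^sub>1\<close>, but the choice must be measurable with respect to the queries
  made so far; without this, it could anticipate the supposedly fresh randomness.
\<close>

definition universal_fast_sgd ::
  "real^'n^'n \<Rightarrow> (real^'n \<Rightarrow> ereal) \<Rightarrow> 'q measure \<Rightarrow> (real^'n \<Rightarrow> 'q \<Rightarrow> real^'n) \<Rightarrow>
   'n stepsize_rule \<Rightarrow> real \<Rightarrow> real^'n \<Rightarrow> 'w measure \<Rightarrow> (nat \<Rightarrow> 'w \<Rightarrow> 'q) \<Rightarrow>
   (nat \<Rightarrow> 'w \<Rightarrow> real^'n) \<Rightarrow> (nat \<Rightarrow> 'w \<Rightarrow> real^'n) \<Rightarrow> (nat \<Rightarrow> 'w \<Rightarrow> real^'n) \<Rightarrow>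
   (nat \<Rightarrow> 'w \<Rightarrow> real) \<Rightarrow> bool" where
  "universal_fast_sgd B psi Q g Mplus D x0 P \<xi> x y v M \<longleftrightarrow>
     (\<forall>w\<in>space P. x 0 w = x0 \<and> v 0 w = x0 \<and> M 0 w = 0) \<and>
     (\<forall>k. v (Suc k) \<in> borel_measurable (history P Q \<xi> (2 * k + 1))) \<and>
     (\<forall>k. \<forall>w\<in>space P.
        let a = a_seq (Suc k); A = A_seq k; A' = A_seq (Suc k);
            gy = g (y k w) (\<xi> (2 * k) w);
            gx = g (x (Suc k) w) (\<xi> (2 * k + 1) w)
        in y k w = (A / A') *\<^sub>R x k w + (a / A') *\<^sub>R v k w \<and>
           v (Suc k) w \<in> prox_set B psi (v k w) gy (M k w / a) \<and>
           x (Suc k) w = (A / A') *\<^sub>R x k w + (a / A') *\<^sub>R v (Suc k) w \<and>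
           M (Suc k) w = a\<^sup>2 / A' *
             Mplus (A' / a\<^sup>2 * M k w) (a\<^sup>2 / A'\<^sup>2 * D\<^sup>2) (y k w) (x (Suc k) w) gy gx)"

end

theory Submission
  imports Defs
begin

text \<open>
  The three-point inequality for the proximal step, combined with the model of \<open>f\<close> at \<open>y\<^sub>k\<close>, shows
  that the potential \<open>A\<^sub>k (F (x\<^sub>k) - F (x\<^sup>*)) + M\<^sub>k / 2 * \<parallel>x\<^sup>* - v\<^sub>k\<parallel>\<^sup>2\<close> grows in one iteration by at
  most \<open>A\<^sub>k\<^sub>+\<^sub>1\<close> times the left-hand side of the stepsize requirement, plus \<open>a\<^sub>k\<^sub>+\<^sub>1\<close> times the inner
  product of the query error at \<open>y\<^sub>k\<close> with \<open>v\<^sub>k - x\<^sup>*\<close>. The latter has mean zero because \<open>v\<^sub>k\<close> and \<open>y\<^sub>k\<close>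
  are independent of the randomness of that query. The requirement is applied with the threshold
  \<open>A\<^sub>k\<^sub>+\<^sub>1 / a\<^sub>k\<^sub>+\<^sub>1\<^sup>2 * (c\<^sub>2 L + \<rho>)\<close>. Since the \<open>M\<^sub>k\<close> increase, its last term then becomes the increment
  of \<open>c\<^sub>4 D\<^sup>2 min {M\<^sub>k, c\<^sub>2 L + \<rho>}\<close>, which telescopes to at most \<open>c\<^sub>4 D\<^sup>2 (c\<^sub>2 L + \<rho>)\<close>. Optimising over
  \<open>\<rho> > 0\<close> gives the bound.
\<close>

section \<open>Norms induced by a positive definite matrix\<close>

lemma mnorm_power2:
  assumes "positive_definite B"
  shows "(mnorm B x)\<^sup>2 = (B *v x) \<bullet> x"
proof -
  have "(B *v x) \<bullet> x \<ge> 0"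
    using assms unfolding positive_definite_def by (cases "x = 0") (auto intro: less_imp_le)
  then show ?thesis by (simp add: mnorm_def)
qed

lemma positive_definite_inner_commute:
  assumes "positive_definite B"
  shows "(B *v x) \<bullet> y = (B *v y) \<bullet> x"
proof -
  have "x v* B = B *v x"
    using assms transpose_matrix_vector[of B x] by (simp add: positive_definite_def)
  then show ?thesis
    using dot_lmul_matrix[of x B y] by (simp add: inner_commute)
qed

lemma mnorm_nonneg:
  assumes "positive_definite B"
  shows "mnorm B x \<ge> 0"
  using mnorm_power2[OF assms, of x] assms unfolding mnorm_def positive_definite_def
  by (metis inner_zero_right le_less real_sqrt_ge_0_iff zero_le_power2)

lemma mnorm_scaleR: "mnorm B (c *\<^sub>R x) = \<bar>c\<bar> * mnorm B x"
  by (simp add: mnorm_def matrix_vector_mult_scaleR real_sqrt_mult mult.assoc[symmetric]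
      power2_eq_square[symmetric])

lemma mnorm_eq_0_iff:
  assumes "positive_definite B"
  shows "mnorm B x = 0 \<longleftrightarrow> x = 0"
  using assms unfolding mnorm_def positive_definite_def by force

lemma continuous_on_mnorm: "continuous_on UNIV (mnorm B)"
  unfolding mnorm_def
  by (intro continuous_intros linear_continuous_on linear_linear[THEN iffD2] matrix_vector_mul_linear)

lemma mnorm_power2_add:
  assumes "positive_definite B"
  shows "(mnorm B (x + t *\<^sub>R z))\<^sup>2 = (mnorm B x)\<^sup>2 + 2 * t * ((B *v x) \<bullet> z) + t\<^sup>2 * (mnorm B z)\<^sup>2"
  using positive_definite_inner_commute[OF assms, of x z]
  unfolding mnorm_power2[OF assms]
  by (simp add: power2_eq_square matrix_vector_right_distrib inner_add_left inner_add_right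
      matrix_vector_mult_scaleR algebra_simps)

text \<open>By compactness: \<open>mnorm B\<close> is continuous and positive on the Euclidean unit
  sphere, so it attains a positive minimum and a maximum there, and homogeneity carries both bounds
  to all vectors.\<close>

lemma norm_le_mnorm:
  fixes B :: "real^'n^'n"
  assumes "positive_definite B"
  shows "\<exists>C>0. \<forall>x. norm x \<le> C * mnorm B x \<and> mnorm B x \<le> C * norm x"
proof -
  have cont: "continuous_on (sphere 0 1) (mnorm B)"
    using continuous_on_mnorm by (rule continuous_on_subset) simp
  have ne: "sphere (0::real^'n) 1 \<noteq> {}" by simp
  obtain u where u: "u \<in> sphere 0 1" "\<And>x. x \<in> sphere 0 1 \<Longrightarrow> mnorm B u \<le> mnorm B x"
    using continuous_attains_inf[OF compact_sphere ne cont] by blast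
  obtain w where w: "\<And>x. x \<in> sphere 0 1 \<Longrightarrow> mnorm B x \<le> mnorm B w"
    using continuous_attains_sup[OF compact_sphere ne cont] by blast
  have pos: "mnorm B u > 0"
    using u(1) mnorm_eq_0_iff[OF assms, of u] mnorm_nonneg[OF assms, of u] by (cases "u = 0") auto
  define C where "C = max (1 / mnorm B u) (mnorm B w)"
  have C: "1 / mnorm B u \<le> C" "mnorm B w \<le> C" by (auto simp: C_def)
  have "C > 0" using C(1) pos by (meson divide_pos_pos less_le_trans zero_less_one)
  have scale: "mnorm B x = norm x * mnorm B (x /\<^sub>R norm x)" if "x \<noteq> 0" for x
    using that by (simp add: mnorm_scaleR)
  have "norm x \<le> C * mnorm B x" for x
  proof (cases "x = 0")
    case False
    have "1 \<le> C * mnorm B u" using C(1) pos by (simp add: field_simps)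
    also have "\<dots> \<le> C * mnorm B (x /\<^sub>R norm x)"
      using False \<open>C > 0\<close> by (intro mult_left_mono u(2)) auto
    finally show ?thesis
      using scale[OF False] mult_left_mono[of 1 "C * mnorm B (x /\<^sub>R norm x)" "norm x"]
      by (simp add: mult_ac)
  qed (use \<open>C > 0\<close> mnorm_nonneg[OF assms, of 0] in auto)
  moreover have "mnorm B x \<le> C * norm x" for x
  proof (cases "x = 0")
    case False
    have "mnorm B (x /\<^sub>R norm x) \<le> C"
      using w[of "x /\<^sub>R norm x"] C(2) False by auto
    then show ?thesis
      using scale[OF False] mult_left_mono[of "mnorm B (x /\<^sub>R norm x)" C "norm x"]
      by (simp add: mult_ac)
  qed (simp add: mnorm_def)
  ultimately show ?thesis using \<open>C > 0\<close> by blast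
qed

text \<open>The \<open>Sup\<close> in the dual norm is informative only because its set is bounded
  above, which follows from the equivalence with the Euclidean norm. Normalising \<open>x\<close>
  then places it among the competitors.\<close>

lemma inner_le_dual_norm:
  assumes "positive_definite B"
  shows "s \<bullet> x \<le> dual_norm B s * mnorm B x"
proof (cases "x = 0")
  case False
  obtain C where C: "C > 0" "\<And>x. norm x \<le> C * mnorm B x" "\<And>x. mnorm B x \<le> C * norm x"
    using norm_le_mnorm[OF assms] by auto
  have "bdd_above {s \<bullet> x | x. mnorm B x = 1}"
  proof (rule bdd_aboveI, clarify)
    fix z assume "mnorm B z = 1"
    then have "norm z \<le> C" using C(2)[of z] by simp
    then show "s \<bullet> z \<le> norm s * C"
      by (meson mult_left_mono norm_cauchy_schwarz norm_ge_zero order_trans)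
  qed
  moreover have pos: "mnorm B x > 0"
    using False mnorm_eq_0_iff[OF assms, of x] mnorm_nonneg[OF assms, of x] by simp
  then have "s \<bullet> (x /\<^sub>R mnorm B x) \<in> {s \<bullet> x | x. mnorm B x = 1}"
    by (auto simp: mnorm_scaleR intro!: exI[of _ "x /\<^sub>R mnorm B x"])
  ultimately have "s \<bullet> (x /\<^sub>R mnorm B x) \<le> dual_norm B s"
    unfolding dual_norm_def by (intro cSup_upper)
  then show ?thesis using pos by (simp add: field_simps)
qed (simp add: mnorm_def)

text \<open>Testing the dual norm against \<open>s\<close> itself bounds the squared Euclidean norm
  by \<open>dual_norm B s * mnorm B s\<close>, and one factor cancels. This turns a variance
  measured in the dual norm into Euclidean integrability.\<close>

lemma norm_le_dual_norm:
  fixes B :: "real^'n^'n"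
  assumes "positive_definite B"
  shows "\<exists>C>0. \<forall>s. norm s \<le> C * dual_norm B s"
proof -
  obtain C where C: "C > 0" "\<And>x. norm x \<le> C * mnorm B x" "\<And>x. mnorm B x \<le> C * norm x"
    using norm_le_mnorm[OF assms] by auto
  have "norm s \<le> C * dual_norm B s" for s
  proof -
    have d: "dual_norm B s \<ge> 0"
    proof -
      \<comment> \<open>A nonzero test vector with \<open>s \<bullet> z \<ge> 0\<close> forces the
        dual norm to be nonnegative; at \<open>s = 0\<close> a coordinate vector serves.\<close>
      define z where "z = (if s = 0 then axis undefined 1 else s)"
      have "z \<noteq> 0" "s \<bullet> z \<ge> 0" by (auto simp: z_def axis_eq_0_iff)
      then have "dual_norm B s * mnorm B z \<ge> 0" "mnorm B z > 0"
        using inner_le_dual_norm[OF assms, of s z] mnorm_eq_0_iff[OF assms, of z]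
          mnorm_nonneg[OF assms, of z] by auto
      then show ?thesis by (simp add: zero_le_mult_iff)
    qed
    have "norm s * norm s = s \<bullet> s" by (simp add: norm_eq_sqrt_inner)
    also have "\<dots> \<le> dual_norm B s * mnorm B s" by (rule inner_le_dual_norm[OF assms])
    also have "\<dots> \<le> dual_norm B s * (C * norm s)" by (intro mult_left_mono C d)
    finally have "norm s * norm s \<le> (C * dual_norm B s) * norm s" by (simp add: mult_ac)
    then show ?thesis using d C(1) by (cases "s = 0") (auto simp: mult_le_cancel_right)
  qed
  then show ?thesis using C(1) by blast
qed

section \<open>Extended expectations\<close>

lemma ext_expectation_cong:
  assumes "\<And>w. w \<in> space P \<Longrightarrow> X w = Y w"
  shows "ext_expectation P X = ext_expectation P Y"
proof -
  have "(\<integral>\<^sup>+w. e2ennreal (X w) \<partial>P) = (\<integral>\<^sup>+w. e2ennreal (Y w) \<partial>P)"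
    "(\<integral>\<^sup>+w. e2ennreal (- X w) \<partial>P) = (\<integral>\<^sup>+w. e2ennreal (- Y w) \<partial>P)"
    using assms by (auto intro: nn_integral_cong)
  then show ?thesis by (simp add: ext_expectation_def)
qed

lemma well_defined_expectation_cong:
  assumes "\<And>w. w \<in> space P \<Longrightarrow> X w = Y w"
  shows "well_defined_expectation P X \<longleftrightarrow> well_defined_expectation P Y"
proof -
  have "(\<integral>\<^sup>+w. e2ennreal (X w) \<partial>P) = (\<integral>\<^sup>+w. e2ennreal (Y w) \<partial>P)"
    "(\<integral>\<^sup>+w. e2ennreal (- X w) \<partial>P) = (\<integral>\<^sup>+w. e2ennreal (- Y w) \<partial>P)"
    using assms by (auto intro: nn_integral_cong)
  moreover have "X \<in> borel_measurable P \<longleftrightarrow> Y \<in> borel_measurable P"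
    using assms by (intro measurable_cong)
  ultimately show ?thesis by (simp add: well_defined_expectation_def)
qed

lemma integrable_imp_ext_expectation:
  fixes h :: "'w \<Rightarrow> real"
  assumes "integrable P h"
  shows "well_defined_expectation P (\<lambda>w. ereal (h w))"
    and "ext_expectation P (\<lambda>w. ereal (h w)) = ereal (\<integral>w. h w \<partial>P)"
proof -
  have "(\<integral>\<^sup>+w. ennreal (h w) \<partial>P) \<noteq> \<infinity>" "(\<integral>\<^sup>+w. ennreal (- h w) \<partial>P) \<noteq> \<infinity>"
    using assms by (auto simp: real_integrable_def)
  moreover have "h \<in> borel_measurable P" using assms by simp
  ultimately show "well_defined_expectation P (\<lambda>w. ereal (h w))"
    by (auto simp: well_defined_expectation_def less_top)
  obtain r q where "r \<ge> 0" "q \<ge> 0" "(\<integral>\<^sup>+w. ennreal (h w) \<partial>P) = ennreal r"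
    "(\<integral>\<^sup>+w. ennreal (- h w) \<partial>P) = ennreal q" "(\<integral>w. h w \<partial>P) = r - q"
    using assms by (rule integrableE) auto
  then show "ext_expectation P (\<lambda>w. ereal (h w)) = ereal (\<integral>w. h w \<partial>P)"
    by (simp add: ext_expectation_def)
qed

lemma well_defined_expectation_bounded_below:
  fixes h l :: "'w \<Rightarrow> real"
  assumes "h \<in> borel_measurable P" "integrable P l" "\<And>w. w \<in> space P \<Longrightarrow> l w \<le> h w"
  shows "(\<integral>\<^sup>+w. ennreal (- h w) \<partial>P) < \<infinity>"
    and "well_defined_expectation P (\<lambda>w. ereal (h w))"
proof -
  have "(\<integral>\<^sup>+w. ennreal (- h w) \<partial>P) \<le> (\<integral>\<^sup>+w. ennreal (- l w) \<partial>P)"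
    using assms(3) by (intro nn_integral_mono) (auto intro: ennreal_leI)
  also have "\<dots> < \<infinity>" using assms(2) by (auto simp: real_integrable_def less_top)
  finally show *: "(\<integral>\<^sup>+w. ennreal (- h w) \<partial>P) < \<infinity>" .
  then show "well_defined_expectation P (\<lambda>w. ereal (h w))"
    using assms(1) by (simp add: well_defined_expectation_def)
qed

text \<open>The integrable minorant keeps the negative part finite, so an infinite positive part
  would make the extended expectation infinite. This is how a finite bound in the stepsize
  requirement yields integrability along the run.\<close>

lemma integrable_if_ext_expectation_le:
  fixes h l :: "'w \<Rightarrow> real"
  assumes "h \<in> borel_measurable P" "integrable P l" "\<And>w. w \<in> space P \<Longrightarrow> l w \<le> h w"
    and "ext_expectation P (\<lambda>w. ereal (h w)) \<le> ereal c"
  shows "integrable P h" and "(\<integral>w. h w \<partial>P) \<le> c"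
proof -
  note neg = well_defined_expectation_bounded_below(1)[OF assms(1-3)]
  have "(\<integral>\<^sup>+w. ennreal (h w) \<partial>P) \<noteq> \<infinity>"
  proof
    assume "(\<integral>\<^sup>+w. ennreal (h w) \<partial>P) = \<infinity>"
    then show False
      using assms(4) neg
      by (cases "\<integral>\<^sup>+w. ennreal (- h w) \<partial>P") (auto simp: ext_expectation_def)
  qed
  then show h: "integrable P h"
    using assms(1) neg by (auto simp: real_integrable_def)
  show "(\<integral>w. h w \<partial>P) \<le> c"
    using assms(4) integrable_imp_ext_expectation(2)[OF h] by simp
qed

text \<open>Monotonicity of \<open>nn_integral\<close> holds for arbitrary functions, so the oracle
  variances along the iterates can be bounded without a measurability proof.\<close>

lemma (in prob_space) ext_expectation_bounded:
  assumes "\<And>w. w \<in> space M \<Longrightarrow> 0 \<le> X w" "\<And>w. w \<in> space M \<Longrightarrow> X w \<le> ereal c" and "c \<ge> 0"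
  shows "ext_expectation M X \<ge> 0" "ext_expectation M X \<le> ereal c"
proof -
  have "(\<integral>\<^sup>+w. e2ennreal (- X w) \<partial>M) = (\<integral>\<^sup>+w. 0 \<partial>M)"
    using assms(1) by (intro nn_integral_cong e2ennreal_neg) auto
  then have E: "ext_expectation M X = enn2ereal (\<integral>\<^sup>+w. e2ennreal (X w) \<partial>M)"
    by (simp add: ext_expectation_def zero_ennreal.rep_eq)
  show "ext_expectation M X \<ge> 0" by (simp add: E)
  have "(\<integral>\<^sup>+w. e2ennreal (X w) \<partial>M) \<le> (\<integral>\<^sup>+w. ennreal c \<partial>M)"
    using assms(2) by (intro nn_integral_mono) (metis e2ennreal_ereal e2ennreal_mono)
  then have "(\<integral>\<^sup>+w. e2ennreal (X w) \<partial>M) \<le> ennreal c" by (simp add: emeasure_space_1)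
  then show "ext_expectation M X \<le> ereal c"
    unfolding E using assms(3) by (metis enn2ereal_ennreal less_eq_ennreal.rep_eq)
qed

section \<open>Independence\<close>

text \<open>A product of probability laws is determined by its values on rectangles, and there
  independence is the product formula.\<close>

lemma (in prob_space) independent_variables_distr_pair:
  assumes "independent_variables M S X T Y"
  shows "distr M (S \<Otimes>\<^sub>M T) (\<lambda>w. (X w, Y w)) = distr M S X \<Otimes>\<^sub>M distr M T Y"
proof -
  have X[measurable]: "X \<in> measurable M S" and Y[measurable]: "Y \<in> measurable M T"
    and ind: "indep_set (sets (vimage_algebra (space M) X S)) (sets (vimage_algebra (space M) Y T))"
    using assms by (auto simp: independent_variables_def)
  show ?thesis
  proof (rule pair_measure_eqI[symmetric])
    interpret X: prob_space "distr M S X" by (rule prob_space_distr) fact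
    interpret Y: prob_space "distr M T Y" by (rule prob_space_distr) fact
    show "sigma_finite_measure (distr M S X)" "sigma_finite_measure (distr M T Y)"
      by unfold_locales
    show "sets (distr M S X \<Otimes>\<^sub>M distr M T Y) = sets (distr M (S \<Otimes>\<^sub>M T) (\<lambda>w. (X w, Y w)))"
      by (simp cong: sets_pair_measure_cong)
    fix a b assume "a \<in> sets (distr M S X)" "b \<in> sets (distr M T Y)"
    then have ab: "a \<in> sets S" "b \<in> sets T" by simp_all
    have "prob ((X -` a \<inter> space M) \<inter> (Y -` b \<inter> space M)) =
        prob (X -` a \<inter> space M) * prob (Y -` b \<inter> space M)"
      by (intro indep_setD[OF ind] in_vimage_algebra ab)
    moreover have "(\<lambda>w. (X w, Y w)) -` (a \<times> b) \<inter> space M = (X -` a \<inter> space M) \<inter> (Y -` b \<inter> space M)"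
      by auto
    ultimately show "emeasure (distr M S X) a * emeasure (distr M T Y) b =
        emeasure (distr M (S \<Otimes>\<^sub>M T) (\<lambda>w. (X w, Y w))) (a \<times> b)"
      using ab by (simp add: emeasure_distr emeasure_eq_measure ennreal_mult')
  qed
qed

lemma measurable_vimage_algebra_self:
  "f \<in> measurable P N \<Longrightarrow> f \<in> measurable (vimage_algebra (space P) f N) N"
  by (intro measurable_vimage_algebra1) (auto dest: measurable_space)

lemma measurable_from_history:
  assumes "\<And>i. \<xi> i \<in> measurable P Q"
  shows "measurable (history P Q \<xi> n) N \<subseteq> measurable P N"
proof -
  have "(\<lambda>w. \<lambda>i\<in>{..<n}. \<xi> i w) \<in> measurable P (Pi\<^sub>M {..<n} (\<lambda>_. Q))"
    using assms by (intro measurable_restrict)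
  then have "sets (history P Q \<xi> n) \<subseteq> sets P"
    unfolding history_def by (intro sets_image_in_sets) auto
  then show ?thesis by (auto simp: measurable_def history_def)
qed

lemma measurable_history_component:
  assumes "\<And>i. \<xi> i \<in> measurable P Q" and "i < n"
  shows "\<xi> i \<in> measurable (history P Q \<xi> n) Q"
proof -
  have "(\<lambda>w. \<lambda>i\<in>{..<n}. \<xi> i w) \<in> measurable (history P Q \<xi> n) (Pi\<^sub>M {..<n} (\<lambda>_. Q))"
    unfolding history_def using assms(1)
    by (intro measurable_vimage_algebra_self measurable_restrict)
  then have "(\<lambda>w. (\<lambda>i\<in>{..<n}. \<xi> i w) i) \<in> measurable (history P Q \<xi> n) Q"
    by (rule measurable_compose[OF _ measurable_component_singleton]) (use assms(2) in auto)
  then show ?thesis using assms(2) by simp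
qed

lemma measurable_history_mono:
  assumes "\<And>i. \<xi> i \<in> measurable P Q" and "m \<le> n"
  shows "measurable (history P Q \<xi> m) N \<subseteq> measurable (history P Q \<xi> n) N"
proof -
  have "(\<lambda>w. \<lambda>i\<in>{..<m}. \<xi> i w) \<in> measurable (history P Q \<xi> n) (Pi\<^sub>M {..<m} (\<lambda>_. Q))"
    using assms by (intro measurable_restrict measurable_history_component) auto
  then have "sets (history P Q \<xi> m) \<subseteq> sets (history P Q \<xi> n)"
    unfolding history_def by (intro sets_image_in_sets) auto
  then show ?thesis by (auto simp: measurable_def history_def)
qed

text \<open>The history is generated by the samples with index below \<open>n\<close>, and families
  over disjoint index sets are independent. Passing to the smaller sigma-algebras generated by
  \<open>X\<close> and by the single sample preserves this.\<close>

lemma (in prob_space) independent_variables_history: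
  assumes ind: "indep_vars (\<lambda>_. Q) \<xi> UNIV" and X: "X \<in> measurable (history M Q \<xi> n) S"
  shows "independent_variables M S X Q (\<xi> n)"
proof -
  have \<xi>: "\<And>i. \<xi> i \<in> measurable M Q" using ind by (auto simp: indep_vars_def)
  let ?H = "\<lambda>w. \<lambda>i\<in>{..<n}. \<xi> i w" and ?N = "\<lambda>w. \<lambda>i\<in>{n}. \<xi> i w"
  have "indep_var (Pi\<^sub>M {..<n} (\<lambda>_. Q)) ?H (Pi\<^sub>M {n} (\<lambda>_. Q)) ?N"
    by (rule indep_var_restrict[OF ind]) auto
  then have *: "indep_set (sets (history M Q \<xi> n)) (sets (vimage_algebra (space M) ?N (Pi\<^sub>M {n} (\<lambda>_. Q))))"
    by (simp add: indep_var_eq history_def sets_vimage_algebra)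
  have 1: "sets (vimage_algebra (space M) X S) \<subseteq> sets (history M Q \<xi> n)"
    using X by (intro sets_image_in_sets) (auto simp: history_def)
  have 2: "sets (vimage_algebra (space M) (\<xi> n) Q) \<subseteq>
      sets (vimage_algebra (space M) ?N (Pi\<^sub>M {n} (\<lambda>_. Q)))"
  proof (rule sets_image_in_sets)
    have "?N \<in> measurable (vimage_algebra (space M) ?N (Pi\<^sub>M {n} (\<lambda>_. Q))) (Pi\<^sub>M {n} (\<lambda>_. Q))"
      using \<xi> by (intro measurable_vimage_algebra_self measurable_restrict)
    then have "(\<lambda>w. ?N w n) \<in> measurable (vimage_algebra (space M) ?N (Pi\<^sub>M {n} (\<lambda>_. Q))) Q"
      by (rule measurable_compose[OF _ measurable_component_singleton]) auto
    then show "\<xi> n \<in> measurable (vimage_algebra (space M) ?N (Pi\<^sub>M {n} (\<lambda>_. Q))) Q" by simp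
  qed simp
  have "indep_set (sets (vimage_algebra (space M) X S)) (sets (vimage_algebra (space M) (\<xi> n) Q))"
    unfolding indep_sets2_eq
    using subset_trans[OF 1 indep_setD_ev1[OF *]] subset_trans[OF 2 indep_setD_ev2[OF *]]
      indep_setD[OF * subsetD[OF 1] subsetD[OF 2]] by simp
  then show ?thesis
    using \<xi> subsetD[OF measurable_from_history[of \<xi> M Q, OF \<xi>] X]
    by (simp add: independent_variables_def)
qed

section \<open>Convex extended-valued functions and the proximal map\<close>

lemma proper_closed_convex_finite:
  assumes "proper_closed_convex psi" "z \<in> effective_domain psi"
  shows "psi z = ereal (real_of_ereal (psi z))"
  using assms by (cases "psi z") (auto simp: proper_closed_convex_def effective_domain_def)

lemma proper_closed_convex_combination:
  assumes "proper_closed_convex psi" "u \<in> effective_domain psi" "z \<in> effective_domain psi"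
    and "s \<ge> 0" "t \<ge> 0" "s + t = 1"
  shows "s *\<^sub>R u + t *\<^sub>R z \<in> effective_domain psi"
    and "real_of_ereal (psi (s *\<^sub>R u + t *\<^sub>R z)) \<le> s * real_of_ereal (psi u) + t * real_of_ereal (psi z)"
proof -
  have cv: "convex {(x, t::real). psi x \<le> ereal t}"
    using assms(1) by (simp add: proper_closed_convex_def)
  have "(u, real_of_ereal (psi u)) \<in> {(x, t::real). psi x \<le> ereal t}"
    "(z, real_of_ereal (psi z)) \<in> {(x, t::real). psi x \<le> ereal t}"
    using proper_closed_convex_finite[OF assms(1)] assms(2,3) by simp_all
  from convexD[OF cv this assms(4-6)]
  have *: "psi (s *\<^sub>R u + t *\<^sub>R z) \<le> ereal (s * real_of_ereal (psi u) + t * real_of_ereal (psi z))"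
    by simp
  then show dom: "s *\<^sub>R u + t *\<^sub>R z \<in> effective_domain psi"
    unfolding effective_domain_def using less_ereal.simps(4) order.strict_trans1 by blast
  show "real_of_ereal (psi (s *\<^sub>R u + t *\<^sub>R z)) \<le> s * real_of_ereal (psi u) + t * real_of_ereal (psi z)"
    using * proper_closed_convex_finite[OF assms(1) dom] by (metis ereal_less_eq(3))
qed

text \<open>Sublevel sets at real levels are slices of the closed epigraph, hence closed.\<close>

lemma proper_closed_convex_measurable:
  assumes "proper_closed_convex psi"
  shows "psi \<in> borel_measurable borel"
proof (rule borel_measurableI_le)
  fix c :: ereal
  have lev: "{x. psi x \<le> ereal t} \<in> sets borel" for t
  proof -
    have "closed ((\<lambda>x. (x, t)) -` {(x, t::real). psi x \<le> ereal t})"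
      using assms by (intro closed_vimage) (auto simp: proper_closed_convex_def intro!: continuous_intros)
    then show ?thesis by (simp add: vimage_def borel_closed)
  qed
  show "{x \<in> space borel. psi x \<le> c} \<in> sets borel"
  proof (cases c)
    case MInf
    then have "{x \<in> space borel. psi x \<le> c} = {}"
      using assms by (auto simp: proper_closed_convex_def)
    then show ?thesis by simp
  qed (use lev in auto)
qed

text \<open>Minimality of \<open>u\<close> is tested along the segment towards \<open>z\<close>.
  Dividing by the segment parameter and letting it tend to 0 gives the first-order condition, and
  expanding the squared norm around \<open>u\<close> turns that into the inequality. The argument
  includes \<open>M = 0\<close>.\<close>

lemma prox_set_three_points:
  assumes B: "positive_definite B" and psi: "proper_closed_convex psi" and M: "M \<ge> 0"
    and u: "u \<in> prox_set B psi x s M" and z: "z \<in> effective_domain psi"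
  shows "u \<in> effective_domain psi"
    and "s \<bullet> u + real_of_ereal (psi u) + M / 2 * (mnorm B (u - x))\<^sup>2 + M / 2 * (mnorm B (z - u))\<^sup>2
         \<le> s \<bullet> z + real_of_ereal (psi z) + M / 2 * (mnorm B (z - x))\<^sup>2"
proof -
  show ud: "u \<in> effective_domain psi" using u by (simp add: prox_set_def is_arg_min_def)
  let ?p = "\<lambda>z. real_of_ereal (psi z)"
  have min: "s \<bullet> u + ?p u + M / 2 * (mnorm B (u - x))\<^sup>2 \<le> s \<bullet> y + ?p y + M / 2 * (mnorm B (y - x))\<^sup>2"
    if y: "y \<in> effective_domain psi" for y
  proof -
    have "ereal (s \<bullet> u) + psi u + ereal (M / 2 * (mnorm B (u - x))\<^sup>2)
      \<le> ereal (s \<bullet> y) + psi y + ereal (M / 2 * (mnorm B (y - x))\<^sup>2)"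
      using u y by (auto simp: prox_set_def is_arg_min_def not_less)
    then show ?thesis
      by (subst (asm) proper_closed_convex_finite[OF psi ud],
          subst (asm) proper_closed_convex_finite[OF psi y]) simp
  qed
  \<comment> \<open>\<open>G\<close> is an upper bound for the slope at \<open>u\<close> towards
    \<open>z\<close>, with \<open>psi\<close> replaced by its chord; \<open>K\<close> is the
    second-order coefficient.\<close>
  define c where "c = (B *v (u - x)) \<bullet> (z - u)"
  define G where "G = s \<bullet> (z - u) + ?p z - ?p u + M * c"
  define K where "K = M / 2 * (mnorm B (z - u))\<^sup>2"
  have step: "0 \<le> G + t * K" if t: "0 < t" "t \<le> 1" for t
  proof -
    let ?y = "(1 - t) *\<^sub>R u + t *\<^sub>R z"
    have y: "?y \<in> effective_domain psi" "?p ?y \<le> (1 - t) * ?p u + t * ?p z"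
      using proper_closed_convex_combination[OF psi ud z, of "1 - t" t] t by auto
    have e: "?y - x = (u - x) + t *\<^sub>R (z - u)" by (simp add: algebra_simps)
    have "0 \<le> t * G + t\<^sup>2 * K"
      using min[OF y(1)] y(2) unfolding e mnorm_power2_add[OF B] G_def K_def c_def[symmetric]
      by (simp add: inner_add_right inner_diff_right algebra_simps add_divide_distrib)
    then have "0 \<le> t * (G + t * K)" by (simp add: power2_eq_square algebra_simps)
    then show ?thesis using t by (simp add: zero_le_mult_iff)
  qed
  have "0 \<le> G"
  proof (rule tendsto_lowerbound)
    have "((\<lambda>t. G + t * K) \<longlongrightarrow> G + 0 * K) (at_right 0)" by (intro tendsto_intros)
    then show "((\<lambda>t. G + t * K) \<longlongrightarrow> G) (at_right 0)" by simp
    show "\<forall>\<^sub>F t in at_right 0. 0 \<le> G + t * K"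
      unfolding eventually_at_right_field by (intro exI[of _ 1]) (auto intro: step)
  qed simp
  moreover have "(mnorm B (z - x))\<^sup>2 = (mnorm B (u - x))\<^sup>2 + 2 * c + (mnorm B (z - u))\<^sup>2"
    using mnorm_power2_add[OF B, of "u - x" 1 "z - u"] by (simp add: c_def)
  then have "M / 2 * (mnorm B (z - x))\<^sup>2 =
      M / 2 * (mnorm B (u - x))\<^sup>2 + M * c + M / 2 * (mnorm B (z - u))\<^sup>2"
    by (simp add: field_simps)
  ultimately show "s \<bullet> u + ?p u + M / 2 * (mnorm B (u - x))\<^sup>2 + M / 2 * (mnorm B (z - u))\<^sup>2
         \<le> s \<bullet> z + ?p z + M / 2 * (mnorm B (z - x))\<^sup>2"
    unfolding G_def inner_diff_right by linarith
qed

section \<open>Weights and parameter optimisation\<close>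

text \<open>The bound is smallest at \<open>\<rho> = sqrt (\<alpha> / \<beta>)\<close>, where its
  first two terms agree. For \<open>\<alpha> = 0\<close> there is no positive minimiser, and
  \<open>\<rho>\<close> tends to 0 instead.\<close>

lemma le_of_le_trade_off:
  fixes t :: real
  assumes "\<alpha> \<ge> 0" "\<beta> > 0" and le: "\<And>\<rho>. \<rho> > 0 \<Longrightarrow> t \<le> \<alpha> / \<rho> + \<beta> * \<rho> + \<gamma>"
  shows "t \<le> 2 * sqrt (\<alpha> * \<beta>) + \<gamma>"
proof (cases "\<alpha> = 0")
  case True
  have "t \<le> \<gamma> + e" if "e > 0" for e
    using le[of "e / \<beta>"] that \<open>\<beta> > 0\<close> True by simp
  then have "t \<le> \<gamma>" by (rule field_le_epsilon)
  then show ?thesis using True by simp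
next
  case False
  define r q where "r = sqrt \<alpha>" and "q = sqrt \<beta>"
  have pos: "r > 0" "q > 0" and eq: "\<alpha> = r * r" "\<beta> = q * q"
    using assms False by (auto simp: r_def q_def)
  have "\<alpha> / (r / q) = r * q" "\<beta> * (r / q) = r * q" "sqrt (\<alpha> * \<beta>) = r * q"
    using pos by (simp_all add: eq real_sqrt_mult)
  then show ?thesis using le[of "r / q"] divide_pos_pos[OF pos] by linarith
qed

lemma a_seq_Suc: "a_seq (Suc k) = (real k + 1) / 2"
  by (simp add: a_seq_def)

lemma A_seq_closed_form: "A_seq k = real k * (real k + 1) / 4"
  by (induction k) (simp_all add: a_seq_def field_simps)

lemma sum_a_square: "(\<Sum>i<k. (a_seq (Suc i))\<^sup>2) = real k * (real k + 1) * (2 * real k + 1) / 24"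
proof (induction k)
  case (Suc k)
  show ?case
    unfolding sum.lessThan_Suc Suc unfolding a_seq_Suc of_nat_Suc by (simp add: power2_eq_square field_simps)
qed simp

lemma sum_A: "(\<Sum>i<k. A_seq (Suc i)) = real k * (real k + 1) * (real k + 2) / 12"
proof (induction k)
  case (Suc k)
  show ?case
    unfolding sum.lessThan_Suc Suc unfolding A_seq_closed_form of_nat_Suc by (simp add: field_simps)
qed simp

text \<open>This settles the case \<open>D = 0\<close>, in which the expected objective gap is
  zero.\<close>

lemma bound_nonneg:
  fixes \<delta> L D \<sigma> c1 c2 c3 c4 :: real
  assumes "\<delta> \<ge> 0" "L \<ge> 0" "D \<ge> 0" "\<sigma> \<ge> 0" "c1 > 0" "c2 > 0" "c3 > 0" "c4 > 0"
  shows "0 \<le> 4 * c2 * c4 * L * D\<^sup>2 / (real k * (real k + 1))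
    + 4 * \<sigma> * D * sqrt (2 * c1 * c4 / (3 * real k)) + c3 / 3 * (real k + 2) * \<delta>"
  using assms by (intro add_nonneg_nonneg divide_nonneg_nonneg mult_nonneg_nonneg) auto

section \<open>Runs of UniversalFastSgd\<close>

locale fast_sgd_run = prob_space P
  for B :: "real^'n^'n"
    and f fbar :: "real^'n \<Rightarrow> real" and gbar :: "real^'n \<Rightarrow> real^'n"
    and psi :: "real^'n \<Rightarrow> ereal"
    and \<delta> L D \<sigma> c1 c2 c3 c4 :: real
    and Q :: "'q measure" and g :: "real^'n \<Rightarrow> 'q \<Rightarrow> real^'n"
    and P :: "'w measure" and \<xi> :: "nat \<Rightarrow> 'w \<Rightarrow> 'q"
    and Mplus :: "'n stepsize_rule"
    and x0 :: "real^'n" and x y v :: "nat \<Rightarrow> 'w \<Rightarrow> real^'n" and M :: "nat \<Rightarrow> 'w \<Rightarrow> real" +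
  assumes posdef: "positive_definite B"
    and f_convex: "convex_on UNIV f"
    and psi_pcc: "proper_closed_convex psi"
    and smooth: "approximately_smooth B f fbar gbar \<delta> L"
    and fbar_measurable[measurable]: "fbar \<in> borel_measurable borel"
    and diameter: "\<And>z z'. z \<in> effective_domain psi \<Longrightarrow> z' \<in> effective_domain psi \<Longrightarrow> mnorm B (z - z') \<le> D"
    and stoch_oracle: "stochastic_oracle Q g"
    and unbiased: "unbiased_oracle Q g gbar"
    and oracle_variance_le: "\<And>z. z \<in> effective_domain psi \<Longrightarrow> oracle_variance B Q g gbar z \<le> ereal (\<sigma>\<^sup>2)"
    and indep: "indep_vars (\<lambda>_. Q) \<xi> UNIV"
    and law: "\<And>i. distr P Q (\<xi> i) = Q"
    and constants_pos: "c1 > 0" "c2 > 0" "c3 > 0" "c4 > 0"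
    and rule_measurable: "measurable_rule Mplus"
    and requirement: "stepsize_requirement B f fbar gbar \<delta> L psi Q g P Mplus c1 c2 c3 c4"
    and start: "x0 \<in> effective_domain psi"
    and sgd: "universal_fast_sgd B psi Q g Mplus D x0 P \<xi> x y v M"
begin

section \<open>Notation and basic invariants of a run\<close>

abbreviation "\<D> \<equiv> effective_domain psi"
abbreviation "p z \<equiv> real_of_ereal (psi z)"
abbreviation "F z \<equiv> f z + p z"
abbreviation "\<beta> \<equiv> model_error f fbar gbar"
abbreviation "H n \<equiv> history P Q \<xi> n"
abbreviation "a k \<equiv> a_seq (Suc k)"
abbreviation "A k \<equiv> A_seq k"

text \<open>\<open>Mhat\<close> and \<open>\<Omega>\<close> are the arguments that iteration
  \<open>k\<close> passes to the rule, and \<open>Mhat'\<close> is its output. \<open>gap k\<close>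
  is the integrand on the left of the stepsize requirement for this call.\<close>

definition "\<Omega> k = (a k)\<^sup>2 / (A (Suc k))\<^sup>2 * D\<^sup>2"
definition "Mhat k w = A (Suc k) / (a k)\<^sup>2 * M k w"
definition "gy k w = g (y k w) (\<xi> (2 * k) w)"
definition "gx k w = g (x (Suc k) w) (\<xi> (2 * k + 1) w)"
definition "Mhat' k w = Mplus (Mhat k w) (\<Omega> k) (y k w) (x (Suc k) w) (gy k w) (gx k w)"
definition "noise k w = gbar (y k w) - gy k w"
definition "gap k w = \<beta> (y k w) (x (Suc k) w) + noise k w \<bullet> (x (Suc k) w - y k w)
  - Mhat' k w / 2 * (mnorm B (x (Suc k) w - y k w))\<^sup>2 + (Mhat' k w - Mhat k w) * \<Omega> k
  + \<beta> (x (Suc k) w) (y k w)"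

lemma a_pos: "a k > 0" and A_Suc_pos: "A (Suc k) > 0" and A_nonneg: "A k \<ge> 0"
  and A_Suc: "A (Suc k) = A k + a k"
proof -
  show "A (Suc k) = A k + a k" by simp
qed (simp_all add: a_seq_def A_seq_closed_form del: A_seq.simps)

text \<open>The scale factor \<open>A (Suc k) / (a k)\<^sup>2\<close> between \<open>M\<close> and
  \<open>Mhat\<close> is thus at least 1, so rescaling a threshold above \<open>c2 * L\<close> keeps
  it above.\<close>

lemma a_square_le_A: "(a k)\<^sup>2 \<le> A (Suc k)"
  unfolding a_seq_Suc A_seq_closed_form by (simp add: power2_eq_square field_simps)

lemma initial:
  assumes "w \<in> space P"
  shows "x 0 w = x0" "v 0 w = x0" "M 0 w = 0"
  using sgd assms by (auto simp: universal_fast_sgd_def)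

lemma iteration:
  assumes "w \<in> space P"
  shows "y k w = (A k / A (Suc k)) *\<^sub>R x k w + (a k / A (Suc k)) *\<^sub>R v k w"
    and "v (Suc k) w \<in> prox_set B psi (v k w) (gy k w) (M k w / a k)"
    and "x (Suc k) w = (A k / A (Suc k)) *\<^sub>R x k w + (a k / A (Suc k)) *\<^sub>R v (Suc k) w"
    and "M (Suc k) w = (a k)\<^sup>2 / A (Suc k) * Mhat' k w"
  using sgd assms unfolding universal_fast_sgd_def Let_def Mhat'_def Mhat_def \<Omega>_def gy_def gx_def by blast+

lemma weights: "A k / A (Suc k) \<ge> 0" "a k / A (Suc k) \<ge> 0" "A k / A (Suc k) + a k / A (Suc k) = 1"
proof -
  show "A k / A (Suc k) + a k / A (Suc k) = 1"
    using A_Suc_pos[of k] unfolding add_divide_distrib[symmetric] A_Suc[symmetric] by simp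
qed (use a_pos[of k] A_nonneg[of k] A_Suc_pos[of k] in simp_all)

lemma v_Suc_in_dom:
  assumes "w \<in> space P"
  shows "v (Suc k) w \<in> \<D>"
  using iteration(2)[OF assms, of k] by (simp add: prox_set_def is_arg_min_def)

lemma in_dom:
  assumes "w \<in> space P"
  shows v_in_dom: "v k w \<in> \<D>" and x_in_dom: "x k w \<in> \<D>" and y_in_dom: "y k w \<in> \<D>"
proof -
  show v: "v k w \<in> \<D>" for k
    using v_Suc_in_dom[OF assms] initial[OF assms] start by (cases k) auto
  show x: "x k w \<in> \<D>" for k
  proof (induction k)
    case (Suc k)
    then show ?case
      unfolding iteration(3)[OF assms]
      by (intro proper_closed_convex_combination(1)[OF psi_pcc] v weights)
  qed (use initial[OF assms] start in simp)
  show "y k w \<in> \<D>"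
    unfolding iteration(1)[OF assms]
    by (intro proper_closed_convex_combination(1)[OF psi_pcc] x v weights)
qed

lemma model_error_nonneg: "\<beta> z z' \<ge> 0"
  using smooth by (auto simp: approximately_smooth_def)

lemma L_nonneg: "L \<ge> 0" and \<delta>_nonneg: "\<delta> \<ge> 0"
  using smooth by (auto simp: approximately_smooth_def)

section \<open>Measurability of the problem data\<close>

lemma \<xi>_measurable[measurable]: "\<xi> i \<in> measurable P Q"
  using indep by (auto simp: indep_vars_def)

lemma prob_space_Q: "prob_space Q"
  using stoch_oracle by (simp add: stochastic_oracle_def)

lemma oracle_measurable[measurable (raw)]:
  assumes "X \<in> borel_measurable N" "Z \<in> measurable N Q"
  shows "(\<lambda>w. g (X w) (Z w)) \<in> borel_measurable N"
proof -
  have "(\<lambda>w. (X w, Z w)) \<in> measurable N (borel \<Otimes>\<^sub>M Q)" using assms by simp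
  from measurable_compose[OF this, of "\<lambda>(z, q). g z q" borel] show ?thesis
    using stoch_oracle by (simp add: stochastic_oracle_def)
qed

text \<open>By unbiasedness \<open>gbar\<close> is the integral of the jointly measurable
  \<open>g\<close> over the sample.\<close>

lemma gbar_measurable[measurable]: "gbar \<in> borel_measurable borel"
proof -
  interpret Q: prob_space Q by (rule prob_space_Q)
  have "(\<lambda>z. \<integral>q. g z q \<partial>Q) \<in> borel_measurable borel"
    using stoch_oracle by (intro Q.borel_measurable_lebesgue_integral) (simp add: stochastic_oracle_def)
  moreover have "(\<lambda>z. \<integral>q. g z q \<partial>Q) = gbar"
    using unbiased by (simp add: unbiased_oracle_def fun_eq_iff)
  ultimately show ?thesis by simp
qed

lemma f_measurable[measurable]: "f \<in> borel_measurable borel"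
  using f_convex by (intro borel_measurable_continuous_onI convex_on_continuous) auto

lemma psi_measurable[measurable]: "psi \<in> borel_measurable borel"
  by (rule proper_closed_convex_measurable[OF psi_pcc])

lemma mnorm_measurable[measurable]: "mnorm B \<in> borel_measurable borel"
  using continuous_on_mnorm by (rule borel_measurable_continuous_onI)

lemma model_error_measurable[measurable (raw)]:
  assumes [measurable]: "X \<in> borel_measurable N" "Z \<in> borel_measurable N"
  shows "(\<lambda>w. \<beta> (X w) (Z w)) \<in> borel_measurable N"
  unfolding model_error_def by measurable

end

text \<open>A positive diameter makes every \<open>\<Omega> k\<close> positive, the range for which
  the rule is measurable and its requirement is stated. The case \<open>D = 0\<close> is treated
  directly in the theorem.\<close>

locale nondegenerate_fast_sgd_run = fast_sgd_run +
  assumes D_pos: "D > 0"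
begin

section \<open>Adaptedness of the iterates and freshness of the queries\<close>

lemma \<Omega>_pos: "\<Omega> k > 0"
  using a_pos[of k] A_Suc_pos[of k] D_pos unfolding \<Omega>_def by (intro mult_pos_pos divide_pos_pos) auto

lemma Mplus_measurable:
  assumes "m \<in> borel_measurable N" "X \<in> borel_measurable N" "X' \<in> borel_measurable N"
    "G \<in> borel_measurable N" "G' \<in> borel_measurable N" and "\<omega> > 0"
  shows "(\<lambda>w. Mplus (m w) \<omega> (X w) (X' w) (G w) (G' w)) \<in> borel_measurable N"
proof -
  have "(\<lambda>w. (m w, X w, X' w, G w, G' w)) \<in> borel_measurable N"
    using assms by (intro borel_measurable_Pair)
  from measurable_compose[OF this, of "\<lambda>(M, x, x', gx, gx'). Mplus M \<omega> x x' gx gx'" borel] show ?thesis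
    using rule_measurable \<open>\<omega> > 0\<close> by (simp add: measurable_rule_def)
qed

lemma H_mono: "X \<in> measurable (H m) N \<Longrightarrow> m \<le> n \<Longrightarrow> X \<in> measurable (H n) N"
  using measurable_history_mono[of \<xi> P Q m n N] by auto

lemma H_imp_measurable: "X \<in> measurable (H n) N \<Longrightarrow> X \<in> measurable P N"
  using measurable_from_history[of \<xi> P Q n N] by auto

lemma space_H[simp]: "space (H n) = space P"
  by (simp add: history_def)

text \<open>\<open>H n\<close> knows the samples with index below \<open>n\<close>. The point
  \<open>y k\<close> is determined before sample \<open>2 * k\<close> is drawn,
  \<open>x (Suc k)\<close> once that sample is known, and \<open>M (Suc k)\<close> only after sample
  \<open>2 * k + 1\<close>.\<close>

lemma adapted_Suc:
  assumes [measurable]: "x k \<in> borel_measurable (H (2 * k))" "v k \<in> borel_measurable (H (2 * k))"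
    "M k \<in> borel_measurable (H (2 * k))"
  shows "y k \<in> borel_measurable (H (2 * k))"
    and "x (Suc k) \<in> borel_measurable (H (2 * k + 1))"
    and "gy k \<in> borel_measurable (H (2 * k + 1))"
    and "M (Suc k) \<in> borel_measurable (H (2 * Suc k))"
proof -
  have "(\<lambda>w. (A k / A (Suc k)) *\<^sub>R x k w + (a k / A (Suc k)) *\<^sub>R v k w) \<in> borel_measurable (H (2 * k))"
    by measurable
  \<comment> \<open>The recursion is known only on \<open>space P\<close>, so measurability is
    transferred by congruence on that space.\<close>
  then show y: "y k \<in> borel_measurable (H (2 * k))"
    by (rule measurable_cong[THEN iffD1, rotated]) (simp add: iteration(1))
  have [measurable]: "v (Suc k) \<in> borel_measurable (H (2 * k + 1))"
    using sgd by (simp add: universal_fast_sgd_def)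
  have [measurable]: "x k \<in> borel_measurable (H (2 * k + 1))" "y k \<in> borel_measurable (H (2 * k + 1))"
    by (rule H_mono[OF assms(1)] H_mono[OF y]; simp)+
  have "(\<lambda>w. (A k / A (Suc k)) *\<^sub>R x k w + (a k / A (Suc k)) *\<^sub>R v (Suc k) w)
      \<in> borel_measurable (H (2 * k + 1))"
    by measurable
  then show x: "x (Suc k) \<in> borel_measurable (H (2 * k + 1))"
    by (rule measurable_cong[THEN iffD1, rotated]) (simp add: iteration(3))
  have [measurable]: "\<xi> (2 * k) \<in> measurable (H (2 * k + 1)) Q"
    by (rule measurable_history_component) simp_all
  show gy: "gy k \<in> borel_measurable (H (2 * k + 1))"
    unfolding gy_def by measurable
  have [measurable]: "x (Suc k) \<in> borel_measurable (H (2 * Suc k))" "y k \<in> borel_measurable (H (2 * Suc k))"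
    "gy k \<in> borel_measurable (H (2 * Suc k))" "M k \<in> borel_measurable (H (2 * Suc k))"
    "\<xi> (2 * k + 1) \<in> measurable (H (2 * Suc k)) Q"
    by (rule H_mono[OF x] H_mono[OF y] H_mono[OF gy] H_mono[OF assms(3)] measurable_history_component; simp)+
  have [measurable]: "gx k \<in> borel_measurable (H (2 * Suc k))" "Mhat k \<in> borel_measurable (H (2 * Suc k))"
    unfolding gx_def Mhat_def by measurable
  have [measurable]: "Mhat' k \<in> borel_measurable (H (2 * Suc k))"
    unfolding Mhat'_def by (intro Mplus_measurable \<Omega>_pos) measurable
  have "(\<lambda>w. (a k)\<^sup>2 / A (Suc k) * Mhat' k w) \<in> borel_measurable (H (2 * Suc k))"
    by measurable
  then show "M (Suc k) \<in> borel_measurable (H (2 * Suc k))"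
    by (rule measurable_cong[THEN iffD1, rotated]) (simp add: iteration(4))
qed

lemma adapted:
  "x k \<in> borel_measurable (H (2 * k)) \<and> v k \<in> borel_measurable (H (2 * k)) \<and> M k \<in> borel_measurable (H (2 * k))"
proof (induction k)
  case 0
  have "(\<lambda>_. x0) \<in> borel_measurable (H (2 * 0))" "(\<lambda>_. 0 :: real) \<in> borel_measurable (H (2 * 0))" by simp_all
  then show ?case
    using measurable_cong[of "H (2 * 0)" "x 0" "\<lambda>_. x0" borel] measurable_cong[of "H (2 * 0)" "v 0" "\<lambda>_. x0" borel]
      measurable_cong[of "H (2 * 0)" "M 0" "\<lambda>_. 0" borel] initial by auto
next
  case (Suc k)
  have "v (Suc k) \<in> borel_measurable (H (2 * k + 1))"
    using sgd by (simp add: universal_fast_sgd_def)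
  then have "v (Suc k) \<in> borel_measurable (H (2 * Suc k))"
    by (rule H_mono) simp
  moreover have "x (Suc k) \<in> borel_measurable (H (2 * Suc k))"
    using Suc by (intro H_mono[OF adapted_Suc(2)]) auto
  ultimately show ?case using adapted_Suc(4) Suc by blast
qed

lemmas x_adapted = adapted[THEN conjunct1] and v_adapted = adapted[THEN conjunct2, THEN conjunct1]
  and M_adapted = adapted[THEN conjunct2, THEN conjunct2]
lemmas y_adapted = adapted_Suc(1)[OF x_adapted v_adapted M_adapted]
  and x_Suc_adapted = adapted_Suc(2)[OF x_adapted v_adapted M_adapted]

lemma iterates_measurable[measurable]:
  "x k \<in> borel_measurable P" "y k \<in> borel_measurable P" "v k \<in> borel_measurable P" "M k \<in> borel_measurable P"
  by (rule H_imp_measurable[OF x_adapted] H_imp_measurable[OF y_adapted]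
      H_imp_measurable[OF v_adapted] H_imp_measurable[OF M_adapted])+

lemma derived_measurable[measurable]:
  "Mhat k \<in> borel_measurable P" "gy k \<in> borel_measurable P" "gx k \<in> borel_measurable P"
  "noise k \<in> borel_measurable P"
  unfolding Mhat_def gy_def gx_def noise_def by measurable

lemma Mhat'_measurable[measurable]: "Mhat' k \<in> borel_measurable P"
  unfolding Mhat'_def by (intro Mplus_measurable \<Omega>_pos) measurable

lemma gap_measurable[measurable]: "gap k \<in> borel_measurable P"
  unfolding gap_def by measurable

text \<open>\<open>y k\<close> depends on samples below \<open>2 * k\<close>, and
  \<open>x (Suc k)\<close> and \<open>Mhat k\<close> on samples up to \<open>2 * k\<close>, so both
  queries are fresh in the required sense. Nonnegativity of \<open>M k\<close> is an assumption
  because its inductive proof goes through this lemma.\<close>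

lemma requirement_applied:
  assumes "\<And>w. w \<in> space P \<Longrightarrow> M k w \<ge> 0"
  shows "w \<in> space P \<Longrightarrow> Mhat k w \<le> Mhat' k w"
    and "Mbar > c2 * L \<Longrightarrow> well_defined_expectation P (\<lambda>w. ereal (gap k w)) \<Longrightarrow>
      ext_expectation P (\<lambda>w. ereal (gap k w)) \<le>
        ereal (c1 / (Mbar - c2 * L)) *
          ext_expectation P (\<lambda>w. oracle_variance B Q g gbar (x (Suc k) w) + oracle_variance B Q g gbar (y k w))
        + ereal (c3 * \<delta>)
        + ereal c4 * ext_expectation P (\<lambda>w. ereal (max (min (Mhat' k w) Mbar - Mhat k w) 0 * \<Omega> k))"
proof -
  have [measurable]: "y k \<in> borel_measurable (H (2 * k + 1))" "M k \<in> borel_measurable (H (2 * k + 1))"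
    "x (Suc k) \<in> borel_measurable (H (2 * k + 1))" "\<xi> (2 * k) \<in> measurable (H (2 * k + 1)) Q"
    by (rule H_mono[OF y_adapted] H_mono[OF M_adapted] x_Suc_adapted measurable_history_component; simp)+
  have "independent_variables P borel (y k) Q (\<xi> (2 * k))"
    by (rule independent_variables_history[OF indep y_adapted])
  moreover have "independent_variables P (borel \<Otimes>\<^sub>M Q \<Otimes>\<^sub>M borel \<Otimes>\<^sub>M borel)
      (\<lambda>w. (y k w, \<xi> (2 * k) w, Mhat k w, x (Suc k) w)) Q (\<xi> (2 * k + 1))"
    unfolding Mhat_def by (rule independent_variables_history[OF indep]) measurable
  moreover have "\<forall>w\<in>space P. Mhat k w \<ge> 0"
    using assms a_pos[of k] A_Suc_pos[of k] by (simp add: Mhat_def del: A_seq.simps)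
  ultimately have *: "\<Omega> k > 0 \<and>
       y k \<in> borel_measurable P \<and> (\<forall>w\<in>space P. y k w \<in> \<D>) \<and>
       x (Suc k) \<in> borel_measurable P \<and> (\<forall>w\<in>space P. x (Suc k) w \<in> \<D>) \<and>
       Mhat k \<in> borel_measurable P \<and> (\<forall>w\<in>space P. Mhat k w \<ge> 0) \<and>
       \<xi> (2 * k) \<in> measurable P Q \<and> distr P Q (\<xi> (2 * k)) = Q \<and>
       \<xi> (2 * k + 1) \<in> measurable P Q \<and> distr P Q (\<xi> (2 * k + 1)) = Q \<and>
       independent_variables P borel (y k) Q (\<xi> (2 * k)) \<and>
       independent_variables P (borel \<Otimes>\<^sub>M Q \<Otimes>\<^sub>M borel \<Otimes>\<^sub>M borel)
         (\<lambda>w. (y k w, \<xi> (2 * k) w, Mhat k w, x (Suc k) w)) Q (\<xi> (2 * k + 1))"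
    using \<Omega>_pos in_dom law by simp
  note R = requirement[unfolded stepsize_requirement_def Let_def, rule_format, OF *,
      folded gy_def gx_def, folded Mhat'_def noise_def, folded gap_def]
  show "w \<in> space P \<Longrightarrow> Mhat k w \<le> Mhat' k w" using R by blast
  show "Mbar > c2 * L \<Longrightarrow> well_defined_expectation P (\<lambda>w. ereal (gap k w)) \<Longrightarrow>
      ext_expectation P (\<lambda>w. ereal (gap k w)) \<le>
        ereal (c1 / (Mbar - c2 * L)) *
          ext_expectation P (\<lambda>w. oracle_variance B Q g gbar (x (Suc k) w) + oracle_variance B Q g gbar (y k w))
        + ereal (c3 * \<delta>)
        + ereal c4 * ext_expectation P (\<lambda>w. ereal (max (min (Mhat' k w) Mbar - Mhat k w) 0 * \<Omega> k))"
    using R by blast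
qed

section \<open>Monotone stepsize coefficients and the step length\<close>

lemma M_eq_Mhat: "M k w = (a k)\<^sup>2 / A (Suc k) * Mhat k w"
  using a_pos[of k] A_Suc_pos[of k] by (simp add: Mhat_def del: A_seq.simps)

lemma M_nonneg: "w \<in> space P \<Longrightarrow> M k w \<ge> 0"
proof (induction k arbitrary: w)
  case (Suc k)
  have "Mhat k w \<ge> 0"
    using Suc.IH[OF Suc.prems] a_pos[of k] A_Suc_pos[of k] by (simp add: Mhat_def del: A_seq.simps)
  also have "\<dots> \<le> Mhat' k w" using requirement_applied(1) Suc by blast
  finally show ?case
    unfolding iteration(4)[OF Suc.prems] using A_nonneg[of "Suc k"] by (intro mult_nonneg_nonneg) auto
qed (simp add: initial)

lemma Mhat_nonneg: "w \<in> space P \<Longrightarrow> Mhat k w \<ge> 0"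
  using M_nonneg[of w k] a_pos[of k] A_Suc_pos[of k] by (simp add: Mhat_def del: A_seq.simps)

lemma Mhat_le_Mhat': "w \<in> space P \<Longrightarrow> Mhat k w \<le> Mhat' k w"
  using requirement_applied(1) M_nonneg by blast

lemma M_mono: "w \<in> space P \<Longrightarrow> M k w \<le> M (Suc k) w"
  unfolding iteration(4) M_eq_Mhat[of k] using A_nonneg[of "Suc k"]
  by (intro mult_left_mono Mhat_le_Mhat') auto

lemma x_minus_y:
  assumes "w \<in> space P"
  shows "x (Suc k) w - y k w = (a k / A (Suc k)) *\<^sub>R (v (Suc k) w - v k w)"
  unfolding iteration(1)[OF assms] iteration(3)[OF assms] by (simp add: scaleR_diff_right)

text \<open>The step is a multiple of the difference of two points of the domain;
  \<open>\<Omega> k\<close> is exactly the square of that factor times the squared diameter.\<close>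

lemma mnorm_x_minus_y_le:
  assumes "w \<in> space P"
  shows "(mnorm B (x (Suc k) w - y k w))\<^sup>2 \<le> \<Omega> k"
proof -
  have "(mnorm B (v (Suc k) w - v k w))\<^sup>2 \<le> D\<^sup>2"
    using diameter in_dom[OF assms] mnorm_nonneg[OF posdef] by (intro power_mono) auto
  then show ?thesis
    unfolding x_minus_y[OF assms] mnorm_scaleR \<Omega>_def power_mult_distrib power2_abs power_divide
    by (intro mult_left_mono) auto
qed

section \<open>Moments of the query error\<close>

lemma nn_integral_dual_norm_le:
  assumes "z \<in> \<D>"
  shows "(\<integral>\<^sup>+q. ennreal ((dual_norm B (g z q - gbar z))\<^sup>2) \<partial>Q) \<le> ennreal (\<sigma>\<^sup>2)"
proof -
  have "(\<integral>\<^sup>+q. e2ennreal (- ereal ((dual_norm B (g z q - gbar z))\<^sup>2)) \<partial>Q) = (\<integral>\<^sup>+q. 0 \<partial>Q)"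
    by (intro nn_integral_cong e2ennreal_neg) simp
  then have "enn2ereal (\<integral>\<^sup>+q. ennreal ((dual_norm B (g z q - gbar z))\<^sup>2) \<partial>Q) \<le> ereal (\<sigma>\<^sup>2)"
    using oracle_variance_le[OF assms]
    by (simp add: oracle_variance_def ext_expectation_def zero_ennreal.rep_eq del: uminus_ereal.simps)
  then show ?thesis
    by (simp add: less_eq_ennreal.rep_eq enn2ereal_ennreal)
qed

lemma oracle_variance_nonneg: "oracle_variance B Q g gbar z \<ge> 0"
proof -
  have "(\<integral>\<^sup>+q. e2ennreal (- ereal ((dual_norm B (g z q - gbar z))\<^sup>2)) \<partial>Q) = (\<integral>\<^sup>+q. 0 \<partial>Q)"
    by (intro nn_integral_cong e2ennreal_neg) simp
  then show ?thesis
    by (simp add: oracle_variance_def ext_expectation_def zero_ennreal.rep_eq del: uminus_ereal.simps)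
qed

lemma distr_pair_query:
  assumes "X \<in> measurable (H n) N"
  shows "distr P (N \<Otimes>\<^sub>M Q) (\<lambda>w. (X w, \<xi> n w)) = distr P N X \<Otimes>\<^sub>M Q"
  using independent_variables_distr_pair[OF independent_variables_history[OF indep assms]]
  by (simp add: law)

text \<open>The joint law of \<open>X\<close> and the fresh sample is a product, so Tonelli's
  theorem integrates the sample out first.\<close>

lemma nn_integral_query:
  assumes X: "X \<in> measurable (H n) N" and h[measurable]: "h \<in> borel_measurable (N \<Otimes>\<^sub>M Q)"
  shows "(\<integral>\<^sup>+w. h (X w, \<xi> n w) \<partial>P) = (\<integral>\<^sup>+w. (\<integral>\<^sup>+q. h (X w, q) \<partial>Q) \<partial>P)"
proof -
  interpret Q: prob_space Q by (rule prob_space_Q)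
  have [measurable]: "X \<in> measurable P N" by (rule H_imp_measurable[OF X])
  have "(\<integral>\<^sup>+w. h (X w, \<xi> n w) \<partial>P) = (\<integral>\<^sup>+u. h u \<partial>(distr P N X \<Otimes>\<^sub>M Q))"
    unfolding distr_pair_query[OF X, symmetric] by (subst nn_integral_distr) simp_all
  also have "\<dots> = (\<integral>\<^sup>+z. (\<integral>\<^sup>+q. h (z, q) \<partial>Q) \<partial>distr P N X)"
    by (rule Q.nn_integral_fst[symmetric]) (simp cong: measurable_cong_sets)
  also have "\<dots> = (\<integral>\<^sup>+w. (\<integral>\<^sup>+q. h (X w, q) \<partial>Q) \<partial>P)"
    by (subst nn_integral_distr) simp_all
  finally show ?thesis .
qed

text \<open>The variance bound gives a finite second moment, hence a finite first moment, and a
  bounded \<open>W\<close> keeps the inner product integrable. Given \<open>X\<close> and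
  \<open>W\<close>, the fresh sample has mean error zero by unbiasedness. In the application
  \<open>W\<close> is \<open>v k w - z\<close>.\<close>

lemma query_error:
  assumes X: "X \<in> borel_measurable (H n)" and dom: "\<And>w. w \<in> space P \<Longrightarrow> X w \<in> \<D>"
    and W: "W \<in> borel_measurable (H n)" and bnd: "\<And>w. w \<in> space P \<Longrightarrow> norm (W w) \<le> K"
  shows "integrable P (\<lambda>w. norm (gbar (X w) - g (X w) (\<xi> n w)))"
    and "integrable P (\<lambda>w. (gbar (X w) - g (X w) (\<xi> n w)) \<bullet> W w)"
    and "(\<integral>w. (gbar (X w) - g (X w) (\<xi> n w)) \<bullet> W w \<partial>P) = 0"
proof -
  interpret Q: prob_space Q by (rule prob_space_Q)
  have [measurable]: "X \<in> borel_measurable P" "W \<in> borel_measurable P"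
    using X W H_imp_measurable by blast+
  obtain C where C: "C > 0" "\<And>s. norm s \<le> C * dual_norm B s"
    using norm_le_dual_norm[OF posdef] by blast
  let ?e = "\<lambda>w. norm (gbar (X w) - g (X w) (\<xi> n w))"
  have "(\<integral>\<^sup>+w. ennreal ((?e w / C)\<^sup>2) \<partial>P) =
      (\<integral>\<^sup>+w. (\<integral>\<^sup>+q. ennreal ((norm (gbar (X w) - g (X w) q) / C)\<^sup>2) \<partial>Q) \<partial>P)"
    using nn_integral_query[OF X, of "\<lambda>(z, q). ennreal ((norm (gbar z - g z q) / C)\<^sup>2)"] by simp
  also have "\<dots> \<le> (\<integral>\<^sup>+w. ennreal (\<sigma>\<^sup>2) \<partial>P)"
  proof (intro nn_integral_mono)
    fix w assume w: "w \<in> space P"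
    have "(\<integral>\<^sup>+q. ennreal ((norm (gbar (X w) - g (X w) q) / C)\<^sup>2) \<partial>Q) \<le>
        (\<integral>\<^sup>+q. ennreal ((dual_norm B (g (X w) q - gbar (X w)))\<^sup>2) \<partial>Q)"
    proof (intro nn_integral_mono ennreal_leI power_mono)
      fix q show "norm (gbar (X w) - g (X w) q) / C \<le> dual_norm B (g (X w) q - gbar (X w))"
        using C(2)[of "g (X w) q - gbar (X w)"] C(1) by (simp add: field_simps norm_minus_commute)
    qed (use C(1) in simp)
    also have "\<dots> \<le> ennreal (\<sigma>\<^sup>2)" by (rule nn_integral_dual_norm_le[OF dom[OF w]])
    finally show "(\<integral>\<^sup>+q. ennreal ((norm (gbar (X w) - g (X w) q) / C)\<^sup>2) \<partial>Q) \<le> ennreal (\<sigma>\<^sup>2)" .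
  qed
  also have "\<dots> < \<infinity>" by (simp add: emeasure_space_1)
  finally have sq: "integrable P (\<lambda>w. (?e w / C)\<^sup>2)"
    by (intro integrableI_nonneg) auto
  show e: "integrable P ?e"
  proof (rule Bochner_Integration.integrable_bound)
    show "integrable P (\<lambda>w. C * (1 + (?e w / C)\<^sup>2))" using sq by simp
    \<comment> \<open>A number is at most one plus its square, so the second moment dominates the
      first.\<close>
    have le: "t \<le> C * (1 + (t / C)\<^sup>2)" for t
    proof -
      have "s \<le> 1 + s\<^sup>2" for s :: real
        using zero_le_power2[of "s - 1 / 2"] by (simp add: power2_eq_square algebra_simps)
      then have "t / C \<le> 1 + (t / C)\<^sup>2" .
      then show ?thesis using C(1) by (simp add: pos_divide_le_eq mult.commute)
    qed
    show "AE w in P. norm (?e w) \<le> norm (C * (1 + (?e w / C)\<^sup>2))"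
      using order_trans[OF le abs_ge_self] by simp
  qed simp
  show i: "integrable P (\<lambda>w. (gbar (X w) - g (X w) (\<xi> n w)) \<bullet> W w)"
  proof (rule Bochner_Integration.integrable_bound)
    show "integrable P (\<lambda>w. ?e w * K)" using e by simp
    have "\<bar>(gbar (X w) - g (X w) (\<xi> n w)) \<bullet> W w\<bar> \<le> \<bar>?e w * K\<bar>" if "w \<in> space P" for w
      using order_trans[OF Cauchy_Schwarz_ineq2 mult_left_mono[OF bnd[OF that] norm_ge_zero]]
      by (rule order_trans[OF _ abs_ge_self])
    then show "AE w in P. norm ((gbar (X w) - g (X w) (\<xi> n w)) \<bullet> W w) \<le> norm (?e w * K)"
      by simp
  qed simp
  \<comment> \<open>\<open>X\<close> and \<open>W\<close> are treated as one variable so that the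
    sample is independent of them jointly.\<close>
  have Y: "(\<lambda>w. (X w, W w)) \<in> measurable (H n) (borel \<Otimes>\<^sub>M borel)" using X W by simp
  have [measurable]: "(\<lambda>w. (X w, W w)) \<in> measurable P (borel \<Otimes>\<^sub>M borel)" by simp
  let ?N = "distr P (borel \<Otimes>\<^sub>M borel) (\<lambda>w. (X w, W w))"
  let ?h = "\<lambda>u. (gbar (fst (fst u)) - g (fst (fst u)) (snd u)) \<bullet> snd (fst u)"
  interpret N: prob_space ?N by (rule prob_space_distr) simp
  interpret NQ: pair_sigma_finite ?N Q ..
  have h[measurable]: "?h \<in> borel_measurable ((borel \<Otimes>\<^sub>M borel) \<Otimes>\<^sub>M Q)" by measurable
  have "integrable (?N \<Otimes>\<^sub>M Q) ?h"
    unfolding distr_pair_query[OF Y, symmetric] using i by (subst integrable_distr_eq) simp_all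
  note fubini = NQ.integral_fst'[OF this]
  have "(\<integral>w. (gbar (X w) - g (X w) (\<xi> n w)) \<bullet> W w \<partial>P) = (\<integral>u. ?h u \<partial>(?N \<Otimes>\<^sub>M Q))"
    unfolding distr_pair_query[OF Y, symmetric] by (subst integral_distr) simp_all
  also have "\<dots> = (\<integral>u. (\<integral>q. ?h (u, q) \<partial>Q) \<partial>?N)" by (rule fubini[symmetric])
  also have "\<dots> = (\<integral>u. 0 \<partial>?N)"
  proof -
    have "(\<integral>q. (gbar z - g z q) \<bullet> u \<partial>Q) = 0" for z u
    proof -
      have "integrable Q (g z)" "(\<integral>q. g z q \<partial>Q) = gbar z"
        using unbiased by (auto simp: unbiased_oracle_def)
      then show ?thesis by (simp add: Q.prob_space)
    qed
    then show ?thesis by simp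
  qed
  finally show "(\<integral>w. (gbar (X w) - g (X w) (\<xi> n w)) \<bullet> W w \<partial>P) = 0" by simp
qed

lemma norm_bound:
  "\<exists>K\<ge>0. \<forall>z\<in>\<D>. \<forall>z'\<in>\<D>. norm (z - z') \<le> K"
proof -
  obtain C where C: "C > 0" "\<And>x. norm x \<le> C * mnorm B x" "\<And>x. mnorm B x \<le> C * norm x"
    using norm_le_mnorm[OF posdef] by auto
  have "norm (z - z') \<le> C * D" if "z \<in> \<D>" "z' \<in> \<D>" for z z'
  proof -
    have "C * mnorm B (z - z') \<le> C * D" using diameter[OF that] C(1) by simp
    then show ?thesis using C(2)[of "z - z'"] by simp
  qed
  then show ?thesis using C(1) D_pos by (intro exI[of _ "C * D"]) auto
qed

lemma noise_integrable: "integrable P (\<lambda>w. norm (noise k w))"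
  unfolding noise_def gy_def
  by (rule query_error(1)[OF y_adapted y_in_dom, where W = "\<lambda>_. 0" and K = 0]) auto

lemma noise_inner:
  assumes "z \<in> \<D>"
  shows "integrable P (\<lambda>w. noise k w \<bullet> (v k w - z))" and "(\<integral>w. noise k w \<bullet> (v k w - z) \<partial>P) = 0"
proof -
  obtain K where K: "\<And>z z'. z \<in> \<D> \<Longrightarrow> z' \<in> \<D> \<Longrightarrow> norm (z - z') \<le> K" using norm_bound by blast
  have W: "(\<lambda>w. v k w - z) \<in> borel_measurable (H (2 * k))"
    using v_adapted by simp
  show "integrable P (\<lambda>w. noise k w \<bullet> (v k w - z))" "(\<integral>w. noise k w \<bullet> (v k w - z) \<partial>P) = 0"
    unfolding noise_def gy_def
    by (rule query_error(2)[OF y_adapted y_in_dom W] query_error(3)[OF y_adapted y_in_dom W];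
        use K v_in_dom assms in auto)+
qed

section \<open>The expected left-hand side of the requirement and integrability\<close>

text \<open>
  Since \<open>\<parallel>x\<^sub>k\<^sub>+\<^sub>1 - y\<^sub>k\<parallel>\<^sup>2 \<le> \<Omega>\<close>, the term \<open>(M' - M) \<Omega>\<close> outweighs the negative quadratic term,
  which makes the expectation in the requirement well defined and yields the integrability of the
  next stepsize coefficient.
\<close>

lemma gap_lower_bound:
  assumes K: "\<And>z z'. z \<in> \<D> \<Longrightarrow> z' \<in> \<D> \<Longrightarrow> norm (z - z') \<le> K" and w: "w \<in> space P"
  shows "Mhat' k w * \<Omega> k / 2 - Mhat k w * \<Omega> k - K * norm (noise k w) \<le> gap k w"
proof -
  have M': "Mhat' k w \<ge> 0" using Mhat_nonneg[OF w, of k] Mhat_le_Mhat'[OF w, of k] by simp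
  have "\<bar>noise k w \<bullet> (x (Suc k) w - y k w)\<bar> \<le> norm (noise k w) * K"
    using order_trans[OF Cauchy_Schwarz_ineq2 mult_left_mono[OF K norm_ge_zero]] x_in_dom y_in_dom w
    by blast
  moreover have "Mhat' k w / 2 * (mnorm B (x (Suc k) w - y k w))\<^sup>2 \<le> Mhat' k w / 2 * \<Omega> k"
    using M' by (intro mult_left_mono mnorm_x_minus_y_le w) auto
  ultimately show ?thesis
    using model_error_nonneg[of "y k w" "x (Suc k) w"] model_error_nonneg[of "x (Suc k) w" "y k w"]
    unfolding gap_def abs_le_iff by (simp add: algebra_simps)
qed

text \<open>Both coefficients and the threshold carry the factor \<open>?r\<close>, which comes out
  of the clipped difference, and \<open>A (Suc k) * ?r * \<Omega> k\<close> equals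
  \<open>D\<^sup>2\<close>. The result is a difference of consecutive terms, ready to
  telescope.\<close>

lemma clipped_increment:
  assumes Mt: "Mt \<ge> 0" and w: "w \<in> space P"
  shows "A (Suc k) * (max (min (Mhat' k w) (A (Suc k) / (a k)\<^sup>2 * Mt) - Mhat k w) 0 * \<Omega> k)
    = (min (M (Suc k) w) Mt - min (M k w) Mt) * D\<^sup>2"
proof -
  let ?r = "A (Suc k) / (a k)\<^sup>2"
  have r: "?r > 0" using a_pos[of k] A_Suc_pos[of k] by (simp del: A_seq.simps)
  have M': "Mhat' k w = ?r * M (Suc k) w"
    unfolding iteration(4)[OF w] using a_pos[of k] A_Suc_pos[of k] by (simp del: A_seq.simps)
  have "max (min (Mhat' k w) (?r * Mt) - Mhat k w) 0 = ?r * max (min (M (Suc k) w) Mt - M k w) 0"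
    unfolding M' Mhat_def using r
    by (simp add: max_mult_distrib_left min_mult_distrib_left right_diff_distrib del: A_seq.simps)
  \<comment> \<open>As \<open>M\<close> increases, both sides vanish once \<open>M k w\<close>
    exceeds \<open>Mt\<close>; before that, \<open>min (M k w) Mt\<close> is
    \<open>M k w\<close>.\<close>
  also have "max (min (M (Suc k) w) Mt - M k w) 0 = min (M (Suc k) w) Mt - min (M k w) Mt"
    using M_mono[OF w, of k] by (auto simp: max_def min_def)
  finally show ?thesis
    using a_pos[of k] A_Suc_pos[of k] by (simp add: \<Omega>_def power2_eq_square del: A_seq.simps)
qed

lemma clipped_M_integrable:
  assumes "Mt \<ge> 0"
  shows "integrable P (\<lambda>w. min (M k w) Mt)"
proof (rule integrable_const_bound)
  show "AE w in P. norm (min (M k w) Mt) \<le> Mt"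
    using assms M_nonneg[of _ k] by (auto simp: min_def)
qed simp

text \<open>The requirement is used with threshold \<open>?r * Mt\<close>. Its expectation is well
  defined by an integrable minorant of \<open>gap k\<close>, and its right-hand side is finite,
  which gives integrability; multiplying by \<open>A (Suc k)\<close> gives the estimate.\<close>

lemma gap_integrable:
  assumes M: "integrable P (M k)" and Mt: "Mt > c2 * L"
  shows "integrable P (gap k)"
    and "A (Suc k) * (\<integral>w. gap k w \<partial>P) \<le> 2 * c1 * \<sigma>\<^sup>2 / (Mt - c2 * L) * (a k)\<^sup>2 + c3 * \<delta> * A (Suc k)
      + c4 * D\<^sup>2 * ((\<integral>w. min (M (Suc k) w) Mt \<partial>P) - (\<integral>w. min (M k w) Mt \<partial>P))"
proof -
  let ?r = "A (Suc k) / (a k)\<^sup>2"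
  define Mbar where "Mbar = ?r * Mt"
  have r: "?r \<ge> 1" using a_square_le_A[of k] a_pos[of k] by (simp del: A_seq.simps)
  have cL: "c2 * L \<ge> 0" using constants_pos L_nonneg by simp
  have Mt0: "Mt \<ge> 0" using cL Mt by simp
  \<comment> \<open>Since \<open>?r \<ge> 1\<close>, the excess of the scaled threshold over
    \<open>c2 * L\<close> is at least the scaled excess. Dividing \<open>A (Suc k)\<close> by this
    \<open>?r\<close> later leaves the weight \<open>(a k)\<^sup>2\<close> on the variance.\<close>
  have rho: "Mbar - c2 * L \<ge> ?r * (Mt - c2 * L)"
    using mult_right_mono[OF r cL] by (simp add: Mbar_def right_diff_distrib del: A_seq.simps)
  have rho_pos: "?r * (Mt - c2 * L) > 0" using r Mt by (intro mult_pos_pos) auto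
  obtain K where K: "K \<ge> 0" "\<And>z z'. z \<in> \<D> \<Longrightarrow> z' \<in> \<D> \<Longrightarrow> norm (z - z') \<le> K" using norm_bound by blast
  have l: "integrable P (\<lambda>w. - Mhat k w * \<Omega> k - K * norm (noise k w))"
    using M noise_integrable[of k] unfolding Mhat_def by simp
  have lb: "- Mhat k w * \<Omega> k - K * norm (noise k w) \<le> gap k w" if "w \<in> space P" for w
  proof -
    have "Mhat' k w * \<Omega> k / 2 \<ge> 0"
      using Mhat_nonneg[OF that, of k] Mhat_le_Mhat'[OF that, of k] \<Omega>_pos[of k] by simp
    then show ?thesis using gap_lower_bound[OF K(2) that, of k] by simp
  qed
  \<comment> \<open>\<open>T\<close> is the exact expectation of the clipped term, finite because
    the coefficients are cut at \<open>Mt\<close>.\<close>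
  define T where "T = D\<^sup>2 / A (Suc k) * ((\<integral>w. min (M (Suc k) w) Mt \<partial>P) - (\<integral>w. min (M k w) Mt \<partial>P))"
  have "ext_expectation P (\<lambda>w. ereal (max (min (Mhat' k w) Mbar - Mhat k w) 0 * \<Omega> k)) =
      ext_expectation P (\<lambda>w. ereal (D\<^sup>2 / A (Suc k) * (min (M (Suc k) w) Mt - min (M k w) Mt)))"
    using clipped_increment[OF Mt0, of _ k] A_Suc_pos[of k]
    by (intro ext_expectation_cong) (simp add: Mbar_def field_simps del: A_seq.simps)
  also have "\<dots> = ereal T"
    unfolding T_def using clipped_M_integrable[OF Mt0]
    by (subst integrable_imp_ext_expectation(2)) simp_all
  finally have E1: "ext_expectation P (\<lambda>w. ereal (max (min (Mhat' k w) Mbar - Mhat k w) 0 * \<Omega> k)) = ereal T" .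
  let ?V = "ext_expectation P (\<lambda>w. oracle_variance B Q g gbar (x (Suc k) w) + oracle_variance B Q g gbar (y k w))"
  have V: "0 \<le> ?V" "?V \<le> ereal (2 * \<sigma>\<^sup>2)"
  proof -
    have ub: "oracle_variance B Q g gbar (x (Suc k) w) + oracle_variance B Q g gbar (y k w) \<le> ereal (2 * \<sigma>\<^sup>2)"
      if "w \<in> space P" for w
      using add_mono[OF oracle_variance_le[OF x_in_dom[OF that]] oracle_variance_le[OF y_in_dom[OF that]]]
      by simp
    show "0 \<le> ?V" "?V \<le> ereal (2 * \<sigma>\<^sup>2)"
      by (rule ext_expectation_bounded[OF _ ub]; simp add: oracle_variance_nonneg)+
  qed
  have c1: "c1 / (Mbar - c2 * L) \<le> c1 / (?r * (Mt - c2 * L))"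
    by (rule divide_left_mono[OF _ _ mult_pos_pos]) (use rho rho_pos constants_pos(1) in linarith)+
  have "ereal (c1 / (Mbar - c2 * L)) * ?V \<le> ereal (c1 / (?r * (Mt - c2 * L))) * ereal (2 * \<sigma>\<^sup>2)"
  proof (rule ereal_mult_mono)
    show "0 \<le> ereal (c1 / (?r * (Mt - c2 * L)))"
      using divide_nonneg_pos[OF _ rho_pos, of c1] constants_pos(1) by simp
  qed (use V c1 in \<open>simp_all only: ereal_less_eq\<close>)
  from add_right_mono[OF add_right_mono[OF this], of "ereal (c3 * \<delta>)" "ereal c4 * ereal T"]
  have bound: "ereal (c1 / (Mbar - c2 * L)) * ?V + ereal (c3 * \<delta>) + ereal c4 * ereal T
      \<le> ereal (c1 / (?r * (Mt - c2 * L)) * (2 * \<sigma>\<^sup>2) + c3 * \<delta> + c4 * T)"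
    unfolding times_ereal.simps(1) plus_ereal.simps(1) .
  have "Mbar > c2 * L" using rho rho_pos by simp
  from order_trans[OF requirement_applied(2)[OF M_nonneg this
      well_defined_expectation_bounded_below(2)[OF gap_measurable l lb], unfolded E1] bound]
  have "ext_expectation P (\<lambda>w. ereal (gap k w))
      \<le> ereal (c1 / (?r * (Mt - c2 * L)) * (2 * \<sigma>\<^sup>2) + c3 * \<delta> + c4 * T)"
    by simp
  note I = integrable_if_ext_expectation_le[OF gap_measurable l lb this]
  show "integrable P (gap k)" by (rule I(1))
  have "A (Suc k) * (\<integral>w. gap k w \<partial>P)
      \<le> A (Suc k) * (c1 / (?r * (Mt - c2 * L)) * (2 * \<sigma>\<^sup>2) + c3 * \<delta> + c4 * T)"
    using I(2) A_Suc_pos[of k] by (intro mult_left_mono) auto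
  also have "\<dots> = 2 * c1 * \<sigma>\<^sup>2 / (Mt - c2 * L) * (a k)\<^sup>2 + c3 * \<delta> * A (Suc k)
      + c4 * D\<^sup>2 * ((\<integral>w. min (M (Suc k) w) Mt \<partial>P) - (\<integral>w. min (M k w) Mt \<partial>P))"
    using A_Suc_pos[of k] a_pos[of k] Mt unfolding T_def by (simp add: field_simps del: A_seq.simps)
  finally show "A (Suc k) * (\<integral>w. gap k w \<partial>P) \<le> 2 * c1 * \<sigma>\<^sup>2 / (Mt - c2 * L) * (a k)\<^sup>2 + c3 * \<delta> * A (Suc k)
      + c4 * D\<^sup>2 * ((\<integral>w. min (M (Suc k) w) Mt \<partial>P) - (\<integral>w. min (M k w) Mt \<partial>P))" .
qed

text \<open>The lower bound on \<open>gap k\<close> is read as an upper bound on the new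
  coefficient; all its other terms are integrable by the induction hypothesis.\<close>

lemma M_integrable: "integrable P (M k)"
proof (induction k)
  case 0
  show ?case by (subst Bochner_Integration.integrable_cong[where g = "\<lambda>_. 0", OF refl]) (simp_all add: initial)
next
  case (Suc k)
  obtain K where K: "K \<ge> 0" "\<And>z z'. z \<in> \<D> \<Longrightarrow> z' \<in> \<D> \<Longrightarrow> norm (z - z') \<le> K" using norm_bound by blast
  let ?U = "\<lambda>w. gap k w + Mhat k w * \<Omega> k + K * norm (noise k w)"
  \<comment> \<open>\<open>less_add_one\<close> selects the threshold \<open>c2 * L + 1\<close>; its
    value is irrelevant for integrability.\<close>
  have U: "integrable P ?U"
    using gap_integrable(1)[OF Suc less_add_one] Suc noise_integrable[of k] unfolding Mhat_def by simp
  have "integrable P (\<lambda>w. Mhat' k w * \<Omega> k / 2)"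
  proof (rule Bochner_Integration.integrable_bound[OF U])
    have "norm (Mhat' k w * \<Omega> k / 2) \<le> norm (?U w)" if "w \<in> space P" for w
    proof -
      have "Mhat' k w * \<Omega> k / 2 \<ge> 0"
        using Mhat_nonneg[OF that, of k] Mhat_le_Mhat'[OF that, of k] \<Omega>_pos[of k] by simp
      then show ?thesis using gap_lower_bound[OF K(2) that, of k] unfolding real_norm_def by linarith
    qed
    then show "AE w in P. norm (Mhat' k w * \<Omega> k / 2) \<le> norm (?U w)" by simp
  qed simp
  then have scaled: "integrable P (\<lambda>w. (a k)\<^sup>2 / A (Suc k) * (2 / \<Omega> k * (Mhat' k w * \<Omega> k / 2)))"
    by (intro integrable_mult_right)
  have M_eq: "M (Suc k) w = (a k)\<^sup>2 / A (Suc k) * (2 / \<Omega> k * (Mhat' k w * \<Omega> k / 2))"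
    if "w \<in> space P" for w
    using \<Omega>_pos[of k] iteration(4)[OF that, of k] by simp
  have "integrable P (M (Suc k)) \<longleftrightarrow>
      integrable P (\<lambda>w. (a k)\<^sup>2 / A (Suc k) * (2 / \<Omega> k * (Mhat' k w * \<Omega> k / 2)))"
    by (intro Bochner_Integration.integrable_cong refl M_eq)
  then show ?case using scaled by blast
qed

section \<open>The one-step potential inequality\<close>

lemma one_step:
  assumes z: "z \<in> \<D>" and w: "w \<in> space P"
  shows "A (Suc k) * (F (x (Suc k) w) - F z) + M (Suc k) w / 2 * (mnorm B (z - v (Suc k) w))\<^sup>2
    \<le> A k * (F (x k w) - F z) + M k w / 2 * (mnorm B (z - v k w))\<^sup>2
      + A (Suc k) * gap k w + a k * (noise k w \<bullet> (v k w - z))"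
proof -
  define a' A' xk xk' vk vk' yk m m' mh mh' G n s where defs:
    "a' = a k" "A' = A (Suc k)" "xk = x k w" "xk' = x (Suc k) w" "vk = v k w" "vk' = v (Suc k) w"
    "yk = y k w" "m = M k w" "m' = M (Suc k) w" "mh = Mhat k w" "mh' = Mhat' k w"
    "G = gbar (y k w)" "n = noise k w" "s = gy k w"
  have pos: "a' > 0" "A' > 0" and A'_eq: "A' = A k + a'"
    using a_pos A_Suc_pos A_Suc by (simp_all add: defs del: A_seq.simps)
  have m: "m = a'\<^sup>2 / A' * mh" "m' = a'\<^sup>2 / A' * mh'"
    using M_eq_Mhat iteration(4)[OF w] by (simp_all add: defs del: A_seq.simps)
  have mono: "mh \<le> mh'" "m \<le> m'" "0 \<le> m"
    using Mhat_le_Mhat'[OF w] M_mono[OF w] M_nonneg[OF w] by (simp_all add: defs)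
  note dom = in_dom[OF w, of k] v_in_dom[OF w, of "Suc k"]
  let ?q = "\<lambda>u. (mnorm B u)\<^sup>2"
  define r where "r = ?q (xk' - yk)"
  have prox: "s \<bullet> vk' + p vk' + (m / a') / 2 * ?q (vk' - vk) + (m / a') / 2 * ?q (z - vk')
      \<le> s \<bullet> z + p z + (m / a') / 2 * ?q (z - vk)"
    unfolding defs using iteration(2)[OF w] a_pos[of k] M_nonneg[OF w]
    by (intro prox_set_three_points(2)[OF posdef psi_pcc _ _ z]) auto
  have "a' * (s \<bullet> vk' + p vk' + (m / a') / 2 * ?q (vk' - vk) + (m / a') / 2 * ?q (z - vk'))
      \<le> a' * (s \<bullet> z + p z + (m / a') / 2 * ?q (z - vk))"
    using prox pos by (intro mult_left_mono) auto
  then have prox': "a' * (s \<bullet> vk') + a' * p vk' + m / 2 * ?q (vk' - vk) + m / 2 * ?q (z - vk')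
      \<le> a' * (s \<bullet> z) + a' * p z + m / 2 * ?q (z - vk)"
    using pos by (simp add: distrib_left)
  have x': "A' *\<^sub>R xk' = A k *\<^sub>R xk + a' *\<^sub>R vk'"
    using iteration(3)[OF w, of k] pos by (simp add: defs scaleR_add_right del: A_seq.simps)
  have dx: "A' *\<^sub>R (xk' - yk) = a' *\<^sub>R (vk' - vk)"
    using x_minus_y[OF w, of k] pos by (simp add: defs del: A_seq.simps)
  have "G \<bullet> (A' *\<^sub>R xk') = G \<bullet> (A k *\<^sub>R xk + a' *\<^sub>R vk')" by (simp only: x')
  then have Gx: "A' * (G \<bullet> xk') = A k * (G \<bullet> xk) + a' * (G \<bullet> vk')" by (simp add: inner_add_right)
  have "n \<bullet> (A' *\<^sub>R (xk' - yk)) = n \<bullet> (a' *\<^sub>R (vk' - vk))" by (simp only: dx)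
  then have nx: "A' * (n \<bullet> (xk' - yk)) = a' * (n \<bullet> (vk' - vk))" by simp
  have G: "G = n + s" by (simp add: defs noise_def)
  \<comment> \<open>The model at \<open>yk\<close> minorises \<open>f\<close> at \<open>z\<close>
    and at \<open>xk\<close>, while \<open>f xk'\<close> equals the model plus its error. The
    weights \<open>A k\<close> and \<open>a'\<close> are those that form \<open>xk'\<close>.\<close>
  have fz: "a' * f z \<ge> a' * (fbar yk + G \<bullet> (z - yk))"
    using model_error_nonneg[of yk z] pos by (intro mult_left_mono) (auto simp: model_error_def defs)
  have fx: "A k * f xk \<ge> A k * (fbar yk + G \<bullet> (xk - yk))"
    using model_error_nonneg[of yk xk] A_nonneg[of k]
    by (intro mult_left_mono) (auto simp: model_error_def defs)
  have fx': "f xk' = fbar yk + G \<bullet> (xk' - yk) + \<beta> yk xk'"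
    by (simp add: model_error_def defs)
  have "A' * p xk' \<le> A' * (A k / A' * p xk + a' / A' * p vk')"
    unfolding defs iteration(3)[OF w] using A_nonneg[of "Suc k"]
    by (intro mult_left_mono proper_closed_convex_combination(2)[OF psi_pcc] weights dom) auto
  then have px': "A' * p xk' \<le> A k * p xk + a' * p vk'"
    using pos by (simp add: distrib_left)
  have "A' * f xk' = A' * fbar yk + (A k * (G \<bullet> xk) + a' * (G \<bullet> vk')) - A' * (G \<bullet> yk) + A' * \<beta> yk xk'"
    unfolding fx' inner_diff_right Gx[symmetric] by (simp add: algebra_simps)
  also have "\<dots> \<le> A k * f xk + a' * f z + a' * (G \<bullet> (vk' - z)) + A' * \<beta> yk xk'"
    using fz fx unfolding A'_eq inner_diff_right by (simp add: algebra_simps)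
  \<comment> \<open>The error is split at \<open>vk\<close>: its part along \<open>vk' - vk\<close>
    belongs to \<open>gap\<close>, and only \<open>vk - z\<close> is left, which is independent of
    the current query. The part with \<open>s\<close> cancels against the proximal
    inequality.\<close>
  also have "a' * (G \<bullet> (vk' - z)) = A' * (n \<bullet> (xk' - yk)) + a' * (n \<bullet> (vk - z)) + a' * (s \<bullet> vk') - a' * (s \<bullet> z)"
    unfolding nx G by (simp add: inner_add_left inner_diff_right algebra_simps)
  finally have Fx': "A' * F xk' + m / 2 * ?q (vk' - vk) + m / 2 * ?q (z - vk')
      \<le> A k * F xk + a' * F z + m / 2 * ?q (z - vk) + A' * \<beta> yk xk'
        + A' * (n \<bullet> (xk' - yk)) + a' * (n \<bullet> (vk - z))"
    using prox' px' by (simp add: distrib_left)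
  have r_eq: "r = (a' / A')\<^sup>2 * ?q (vk' - vk)"
    unfolding r_def defs x_minus_y[OF w] mnorm_scaleR power_mult_distrib power2_abs ..
  have \<Omega>_eq: "\<Omega> k = (a' / A')\<^sup>2 * D\<^sup>2"
    unfolding \<Omega>_def defs power_divide ..
  have rescale: "A' * (c * ((a' / A')\<^sup>2 * u)) = (a'\<^sup>2 / A' * c) * u" for c u
    using pos by (simp add: power2_eq_square)
  \<comment> \<open>Raising the coefficient costs \<open>(m' - m) / 2\<close> times the squared
    distance from \<open>z\<close> to \<open>vk'\<close>, and \<open>A' * (mh' - mh) / 2\<close>
    times the squared step. Each is at most half of \<open>A' * ((mh' - mh) * \<Omega> k)\<close>,
    so that term of \<open>gap\<close> pays for both.\<close>
  have "m * ?q (vk' - vk) = A' * (mh * r)"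
    unfolding m r_eq rescale ..
  moreover have "A' * ((mh' - mh) * \<Omega> k) = (m' - m) * D\<^sup>2"
    unfolding \<Omega>_eq rescale m right_diff_distrib ..
  moreover have "A' * ((mh' - mh) * r) \<le> A' * ((mh' - mh) * \<Omega> k)"
    using mnorm_x_minus_y_le[OF w, of k] mono pos
    by (intro mult_left_mono) (simp_all only: r_def defs less_imp_le diff_ge_0_iff_ge)
  moreover have "?q (z - vk') \<le> D\<^sup>2"
    unfolding defs using z v_in_dom[OF w] by (intro power_mono diameter mnorm_nonneg[OF posdef])
  then have "(m' - m) * ?q (z - vk') \<le> (m' - m) * D\<^sup>2"
    using mono by (intro mult_left_mono) auto
  moreover have "A' * \<beta> xk' yk \<ge> 0" using model_error_nonneg pos by simp
  moreover have "A' * gap k w = A' * \<beta> yk xk' + A' * (n \<bullet> (xk' - yk)) - A' * (mh' * r) / 2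
      + A' * ((mh' - mh) * \<Omega> k) + A' * \<beta> xk' yk"
    unfolding gap_def r_def defs distrib_left right_diff_distrib by simp
  moreover have "A' * (F xk' - F z) = A' * F xk' - A k * F z - a' * F z"
    "A k * (F xk - F z) = A k * F xk - A k * F z"
    unfolding A'_eq by (simp_all add: algebra_simps)
  ultimately have "A' * (F xk' - F z) + m' / 2 * ?q (z - vk')
      \<le> A k * (F xk - F z) + m / 2 * ?q (z - vk) + A' * gap k w + a' * (n \<bullet> (vk - z))"
    using Fx' by (simp add: left_diff_distrib right_diff_distrib)
  then show ?thesis by (simp only: defs)
qed

section \<open>Summation of the potential and the rate\<close>

lemma M_mnorm_integrable:
  assumes "z \<in> \<D>"
  shows "integrable P (\<lambda>w. M k w / 2 * (mnorm B (z - v k w))\<^sup>2)"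
proof (rule Bochner_Integration.integrable_bound)
  show "integrable P (\<lambda>w. M k w / 2 * D\<^sup>2)" using M_integrable[of k] by simp
  have "norm (M k w / 2 * (mnorm B (z - v k w))\<^sup>2) \<le> norm (M k w / 2 * D\<^sup>2)" if "w \<in> space P" for w
  proof -
    have "(mnorm B (z - v k w))\<^sup>2 \<le> D\<^sup>2"
      using assms v_in_dom[OF that] by (intro power_mono diameter mnorm_nonneg[OF posdef])
    then show ?thesis using M_nonneg[OF that, of k] by (simp add: abs_mult mult_left_mono)
  qed
  then show "AE w in P. norm (M k w / 2 * (mnorm B (z - v k w))\<^sup>2) \<le> norm (M k w / 2 * D\<^sup>2)" by simp
qed simp

text \<open>Minimality of \<open>z\<close> bounds the objective from below, and the one-step
  inequality, without its nonnegative distance term, bounds it from above by integrable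
  terms.\<close>

lemma F_integrable:
  assumes z: "z \<in> \<D>" and min: "\<And>u. u \<in> \<D> \<Longrightarrow> F z \<le> F u"
  shows "integrable P (\<lambda>w. F (x k w))"
proof (induction k)
  case 0
  show ?case
    by (subst Bochner_Integration.integrable_cong[where g = "\<lambda>_. F x0", OF refl]) (simp_all add: initial)
next
  case (Suc k)
  define U where "U w = (A k * (F (x k w) - F z) + M k w / 2 * (mnorm B (z - v k w))\<^sup>2
      + A (Suc k) * gap k w + a k * (noise k w \<bullet> (v k w - z))) / A (Suc k)" for w
  have "integrable P U"
    unfolding U_def using Suc M_mnorm_integrable[OF z] gap_integrable(1)[OF M_integrable less_add_one]
      noise_inner(1)[OF z] by simp
  then have i: "integrable P (\<lambda>w. \<bar>U w\<bar> + \<bar>F z\<bar>)" by simp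
  show ?case
  proof (rule Bochner_Integration.integrable_bound[OF i])
    have "norm (F (x (Suc k) w)) \<le> norm (\<bar>U w\<bar> + \<bar>F z\<bar>)" if "w \<in> space P" for w
    proof -
      have "M (Suc k) w / 2 * (mnorm B (z - v (Suc k) w))\<^sup>2 \<ge> 0"
        using M_nonneg[OF that, of "Suc k"] by simp
      then have "A (Suc k) * (F (x (Suc k) w) - F z) \<le> A (Suc k) * U w"
        using one_step[OF z that, of k] A_Suc_pos[of k] unfolding U_def by (simp del: A_seq.simps)
      then have "F (x (Suc k) w) - F z \<le> U w"
        using A_Suc_pos[of k] by (simp only: mult_le_cancel_left_pos)
      then show ?thesis using min[OF x_in_dom[OF that, of "Suc k"]] unfolding real_norm_def by linarith
    qed
    then show "AE w in P. norm (F (x (Suc k) w)) \<le> norm (\<bar>U w\<bar> + \<bar>F z\<bar>)" by simp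
  qed simp
qed

lemma potential_bound:
  assumes z: "z \<in> \<D>" and min: "\<And>u. u \<in> \<D> \<Longrightarrow> F z \<le> F u" and Mt: "Mt > c2 * L"
  shows "A k * ((\<integral>w. F (x k w) \<partial>P) - F z) + (\<integral>w. M k w / 2 * (mnorm B (z - v k w))\<^sup>2 \<partial>P)
    \<le> 2 * c1 * \<sigma>\<^sup>2 / (Mt - c2 * L) * (\<Sum>i<k. (a i)\<^sup>2) + c3 * \<delta> * (\<Sum>i<k. A (Suc i))
      + c4 * D\<^sup>2 * (\<integral>w. min (M k w) Mt \<partial>P)"
proof (induction k)
  case 0
  \<comment> \<open>Nonnegativity of \<open>Mt\<close> makes the clipped initial coefficient 0
    rather than \<open>Mt\<close>.\<close>
  have Mt0: "Mt \<ge> 0"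
    using Mt constants_pos(2) L_nonneg mult_nonneg_nonneg[of c2 L] by linarith
  have "(\<integral>w. M 0 w / 2 * (mnorm B (z - v 0 w))\<^sup>2 \<partial>P) = (\<integral>w. 0 \<partial>P)"
    by (rule Bochner_Integration.integral_cong) (simp_all add: initial)
  moreover have "(\<integral>w. min (M 0 w) Mt \<partial>P) = (\<integral>w. 0 \<partial>P)"
    using Mt0 by (intro Bochner_Integration.integral_cong) (simp_all add: initial)
  ultimately show ?case by simp
next
  case (Suc k)
  note F = F_integrable[OF z min] and Mi = M_mnorm_integrable[OF z]
  note gap = gap_integrable[OF M_integrable Mt, of k] and n = noise_inner[OF z, of k]
  have "A (Suc k) * ((\<integral>w. F (x (Suc k) w) \<partial>P) - F z) + (\<integral>w. M (Suc k) w / 2 * (mnorm B (z - v (Suc k) w))\<^sup>2 \<partial>P)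
    = (\<integral>w. A (Suc k) * (F (x (Suc k) w) - F z) + M (Suc k) w / 2 * (mnorm B (z - v (Suc k) w))\<^sup>2 \<partial>P)"
    using F[of "Suc k"] Mi[of "Suc k"] by (simp add: prob_space del: A_seq.simps)
  also have "\<dots> \<le> (\<integral>w. A k * (F (x k w) - F z) + M k w / 2 * (mnorm B (z - v k w))\<^sup>2
      + A (Suc k) * gap k w + a k * (noise k w \<bullet> (v k w - z)) \<partial>P)"
    using F[of "Suc k"] Mi[of "Suc k"] F[of k] Mi[of k] gap(1) n(1)
    by (intro integral_mono one_step[OF z]) (simp_all del: A_seq.simps)
  also have "\<dots> = A k * ((\<integral>w. F (x k w) \<partial>P) - F z) + (\<integral>w. M k w / 2 * (mnorm B (z - v k w))\<^sup>2 \<partial>P)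
      + A (Suc k) * (\<integral>w. gap k w \<partial>P) + a k * (\<integral>w. noise k w \<bullet> (v k w - z) \<partial>P)"
    using F[of k] Mi[of k] gap(1) n(1) by (simp add: prob_space del: A_seq.simps)
  \<comment> \<open>The noise term has mean zero, and the clipped difference in the bound for
    \<open>gap k\<close> telescopes with the induction hypothesis.\<close>
  finally show ?case
    using Suc gap(2) n(2) by (simp add: algebra_simps del: A_seq.simps)
qed

lemma convergence_rate:
  assumes z: "z \<in> \<D>" and min: "\<And>u. u \<in> \<D> \<Longrightarrow> F z \<le> F u" and k: "k \<ge> 1" and \<sigma>: "\<sigma> \<ge> 0"
  shows "(\<integral>w. F (x k w) \<partial>P) - F z
    \<le> 4 * c2 * c4 * L * D\<^sup>2 / (real k * (real k + 1))
      + 4 * \<sigma> * D * sqrt (2 * c1 * c4 / (3 * real k)) + c3 / 3 * (real k + 2) * \<delta>"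
proof -
  define E where "E = (\<integral>w. F (x k w) \<partial>P) - F z"
  define S where "S = (\<Sum>i<k. (a i)\<^sup>2)"
  define \<gamma> where "\<gamma> = c3 * \<delta> * (\<Sum>i<k. A (Suc i)) + c4 * D\<^sup>2 * (c2 * L)"
  have kpos: "real k > 0" using k by simp
  have S: "S \<ge> 0" unfolding S_def by (intro sum_nonneg) simp
  have "A k * E \<le> 2 * c1 * \<sigma>\<^sup>2 * S / \<rho> + c4 * D\<^sup>2 * \<rho> + \<gamma>" if "\<rho> > 0" for \<rho>
  proof -
    define Mt where "Mt = c2 * L + \<rho>"
    have Mt: "Mt > c2 * L" "Mt \<ge> 0"
      using that constants_pos(2) L_nonneg by (simp_all add: Mt_def)
    \<comment> \<open>The clipped coefficient is bounded by its threshold, so no bound on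
      \<open>M k\<close> itself is required.\<close>
    have "(\<integral>w. min (M k w) Mt \<partial>P) \<le> (\<integral>w. Mt \<partial>P)"
      using clipped_M_integrable[OF Mt(2)] by (intro integral_mono) auto
    then have "c4 * D\<^sup>2 * (\<integral>w. min (M k w) Mt \<partial>P) \<le> c4 * D\<^sup>2 * Mt"
      using constants_pos(4) by (intro mult_left_mono) (simp_all add: prob_space)
    moreover have "(\<integral>w. M k w / 2 * (mnorm B (z - v k w))\<^sup>2 \<partial>P) \<ge> 0"
      using M_nonneg by (intro integral_nonneg_AE AE_I2) auto
    ultimately have "A k * E \<le> 2 * c1 * \<sigma>\<^sup>2 / (Mt - c2 * L) * S
        + c3 * \<delta> * (\<Sum>i<k. A (Suc i)) + c4 * D\<^sup>2 * Mt"
      using potential_bound[OF z min Mt(1), of k] unfolding E_def S_def by linarith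
    then show ?thesis by (simp add: Mt_def \<gamma>_def algebra_simps)
  qed
  moreover have "2 * c1 * \<sigma>\<^sup>2 * S \<ge> 0" "c4 * D\<^sup>2 > 0" using constants_pos S D_pos by simp_all
  ultimately have main: "A k * E \<le> 2 * sqrt (2 * c1 * \<sigma>\<^sup>2 * S * (c4 * D\<^sup>2)) + \<gamma>"
    by (intro le_of_le_trade_off)
  have A: "A k > 0" using kpos by (simp add: A_seq_closed_form)
  \<comment> \<open>With the closed forms of \<open>S\<close> and \<open>A k\<close>, the variance
    weight \<open>sqrt S / A k\<close> is at most \<open>2 / sqrt (3 * real k)\<close>, the source
    of the \<open>3 * real k\<close> in the rate.\<close>
  have "S * 3 * real k \<le> 4 * (A k)\<^sup>2"
  proof -
    have "4 * (A k)\<^sup>2 - S * 3 * real k = (real k)\<^sup>2 * (real k + 1) / 8"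
      unfolding S_def sum_a_square A_seq_closed_form by (simp add: power2_eq_square field_simps)
    moreover have "(real k)\<^sup>2 * (real k + 1) / 8 \<ge> 0" by simp
    ultimately show ?thesis by linarith
  qed
  then have "S \<le> 4 * (A k)\<^sup>2 / (3 * real k)"
    using kpos by (simp add: field_simps)
  then have "2 * c1 * \<sigma>\<^sup>2 * S * (c4 * D\<^sup>2) \<le> 2 * c1 * \<sigma>\<^sup>2 * (4 * (A k)\<^sup>2 / (3 * real k)) * (c4 * D\<^sup>2)"
    using constants_pos by (intro mult_right_mono mult_left_mono) auto
  also have "\<dots> = (2 * A k * \<sigma> * D)\<^sup>2 * (2 * c1 * c4 / (3 * real k))"
    by (simp add: power2_eq_square field_simps)
  finally have "sqrt (2 * c1 * \<sigma>\<^sup>2 * S * (c4 * D\<^sup>2))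
      \<le> sqrt ((2 * A k * \<sigma> * D)\<^sup>2 * (2 * c1 * c4 / (3 * real k)))"
    by (rule real_sqrt_le_mono)
  also have "\<dots> = 2 * A k * \<sigma> * D * sqrt (2 * c1 * c4 / (3 * real k))"
    unfolding real_sqrt_mult[of "_\<^sup>2"] real_sqrt_abs using A \<sigma> D_pos by simp
  finally have "sqrt (2 * c1 * \<sigma>\<^sup>2 * S * (c4 * D\<^sup>2))
      \<le> 2 * A k * \<sigma> * D * sqrt (2 * c1 * c4 / (3 * real k))" .
  \<comment> \<open>Division by \<open>A k\<close> turns the sum of the weights into
    \<open>(real k + 2) / 3\<close>, and \<open>1 / A k\<close> is
    \<open>4 / (real k * (real k + 1))\<close>.\<close>
  moreover have "\<gamma> = A k * (4 * c2 * c4 * L * D\<^sup>2 / (real k * (real k + 1)) + c3 / 3 * (real k + 2) * \<delta>)"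
  proof -
    define \<kappa> where "\<kappa> = real k * (real k + 1)"
    have "\<kappa> > 0" using kpos by (simp add: \<kappa>_def)
    then show ?thesis
      unfolding \<gamma>_def sum_A unfolding A_seq_closed_form \<kappa>_def[symmetric] by (simp add: field_simps)
  qed
  ultimately have "A k * E \<le> A k * (4 * c2 * c4 * L * D\<^sup>2 / (real k * (real k + 1))
      + 4 * \<sigma> * D * sqrt (2 * c1 * c4 / (3 * real k)) + c3 / 3 * (real k + 2) * \<delta>)"
    using main unfolding distrib_left by linarith
  then show ?thesis using A unfolding E_def by simp
qed

end

theorem theorem5:
  fixes B :: "real^'n^'n"
    and f fbar :: "real^'n \<Rightarrow> real" and gbar :: "real^'n \<Rightarrow> real^'n"
    and psi :: "real^'n \<Rightarrow> ereal"
    and \<delta> L D \<sigma> c1 c2 c3 c4 :: real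
    and Q :: "'q measure" and g :: "real^'n \<Rightarrow> 'q \<Rightarrow> real^'n"
    and P :: "'w measure" and \<xi> :: "nat \<Rightarrow> 'w \<Rightarrow> 'q"
    and Mplus :: "'n stepsize_rule"
    and x0 :: "real^'n" and x y v :: "nat \<Rightarrow> 'w \<Rightarrow> real^'n" and M :: "nat \<Rightarrow> 'w \<Rightarrow> real"
    and k :: nat
  assumes "positive_definite B"
    and "convex_on UNIV f"
    and "proper_closed_convex psi"
    and "\<exists>xs. is_arg_min (objective f psi) (\<lambda>z. z \<in> effective_domain psi) xs"
    and "approximately_smooth B f fbar gbar \<delta> L"
    and "fbar \<in> borel_measurable borel"
    and "\<forall>z\<in>effective_domain psi. \<forall>z'\<in>effective_domain psi. mnorm B (z - z') \<le> D"
    and "stochastic_oracle Q g"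
    and "unbiased_oracle Q g gbar"
    and "\<sigma> \<ge> 0"
    and "(SUP z\<in>effective_domain psi. oracle_variance B Q g gbar z) = ereal (\<sigma>\<^sup>2)"
    and "prob_space P"
    and "prob_space.indep_vars P (\<lambda>_. Q) \<xi> UNIV"
    and "\<forall>i. distr P Q (\<xi> i) = Q"
    and "c1 > 0" and "c2 > 0" and "c3 > 0" and "c4 > 0"
    and "measurable_rule Mplus"
    and "stepsize_requirement B f fbar gbar \<delta> L psi Q g P Mplus c1 c2 c3 c4"
    and "x0 \<in> effective_domain psi"
    and "universal_fast_sgd B psi Q g Mplus D x0 P \<xi> x y v M"
    and "k \<ge> 1"
  shows "well_defined_expectation P (\<lambda>w. objective f psi (x k w)) \<and>
    ext_expectation P (\<lambda>w. objective f psi (x k w))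
      - (INF z\<in>effective_domain psi. objective f psi z)
    \<le> ereal (4 * c2 * c4 * L * D\<^sup>2 / (real k * (real k + 1))
             + 4 * \<sigma> * D * sqrt (2 * c1 * c4 / (3 * real k))
             + c3 / 3 * (real k + 2) * \<delta>)"
proof -
  have variance: "oracle_variance B Q g gbar z \<le> ereal (\<sigma>\<^sup>2)" if "z \<in> effective_domain psi" for z
    using SUP_upper[OF that, of "oracle_variance B Q g gbar"] assms(11) by simp
  interpret prob_space P by fact
  interpret fast_sgd_run B f fbar gbar psi \<delta> L D \<sigma> c1 c2 c3 c4 Q g P \<xi> Mplus x0 x y v M
    using assms variance by unfold_locales auto
  let ?R = "4 * c2 * c4 * L * D\<^sup>2 / (real k * (real k + 1))
    + 4 * \<sigma> * D * sqrt (2 * c1 * c4 / (3 * real k)) + c3 / 3 * (real k + 2) * \<delta>"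
  have obj: "objective f psi z = ereal (F z)" if "z \<in> \<D>" for z
    unfolding objective_def by (subst proper_closed_convex_finite[OF psi_pcc that]) simp
  obtain xs where xs: "xs \<in> \<D>" and "\<And>z. z \<in> \<D> \<Longrightarrow> \<not> objective f psi z < objective f psi xs"
    using assms(4) by (auto simp: is_arg_min_def)
  then have min: "F xs \<le> F z" if "z \<in> \<D>" for z
    using that obj by (metis ereal_less(2) less_ereal.simps(1) not_less)
  have INF: "(INF z\<in>\<D>. objective f psi z) = ereal (F xs)"
  proof (rule antisym)
    show "(INF z\<in>\<D>. objective f psi z) \<le> ereal (F xs)"
      using INF_lower[OF xs, of "objective f psi"] obj[OF xs] by simp
    show "ereal (F xs) \<le> (INF z\<in>\<D>. objective f psi z)"
      by (rule INF_greatest) (simp only: obj min ereal_less_eq)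
  qed
  have D0: "D \<ge> 0"
    using diameter[OF start start] mnorm_nonneg[OF posdef, of "x0 - x0"] by linarith
  \<comment> \<open>If \<open>D = 0\<close>, all points of the domain coincide with the minimiser
    and the gap is zero; otherwise the general rate applies.\<close>
  have key: "integrable P (\<lambda>w. F (x k w)) \<and> (\<integral>w. F (x k w) \<partial>P) - F xs \<le> ?R"
  proof (cases "D = 0")
    case True
    have x_eq: "x k w = xs" if "w \<in> space P" for w
      using diameter[OF x_in_dom[OF that] xs, of k] mnorm_nonneg[OF posdef, of "x k w - xs"]
        mnorm_eq_0_iff[OF posdef, of "x k w - xs"] True by simp
    have "integrable P (\<lambda>w. F (x k w)) \<longleftrightarrow> integrable P (\<lambda>_. F xs)"
      by (rule Bochner_Integration.integrable_cong) (simp_all add: x_eq)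
    moreover have "(\<integral>w. F (x k w) \<partial>P) = (\<integral>_. F xs \<partial>P)"
      by (rule Bochner_Integration.integral_cong) (simp_all add: x_eq)
    ultimately show ?thesis
      using bound_nonneg[OF \<delta>_nonneg L_nonneg D0 \<open>\<sigma> \<ge> 0\<close> constants_pos, of k] by (simp add: prob_space)
  next
    case False
    then interpret nondegenerate_fast_sgd_run B f fbar gbar psi \<delta> L D \<sigma> c1 c2 c3 c4 Q g P \<xi> Mplus x0 x y v M
      using D0 by unfold_locales simp
    show ?thesis using F_integrable[OF xs min] convergence_rate[OF xs min \<open>k \<ge> 1\<close> \<open>\<sigma> \<ge> 0\<close>] by blast
  qed
  have eq: "objective f psi (x k w) = ereal (F (x k w))" if "w \<in> space P" for w
    by (rule obj[OF x_in_dom[OF that]])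
  have "well_defined_expectation P (\<lambda>w. objective f psi (x k w)) \<longleftrightarrow>
      well_defined_expectation P (\<lambda>w. ereal (F (x k w)))"
    by (rule well_defined_expectation_cong) (rule eq)
  moreover have "ext_expectation P (\<lambda>w. objective f psi (x k w)) =
      ext_expectation P (\<lambda>w. ereal (F (x k w)))"
    by (rule ext_expectation_cong) (rule eq)
  moreover note integrable_imp_ext_expectation[OF key[THEN conjunct1]]
  ultimately show ?thesis
    using key unfolding INF by simp
qed
end
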